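(* Let $\mathcal{F} = \{f_i\}_{i \in I}$ be a frame sequence in $H$ with frame bounds $A$, $B$, let $a \colon I \to G$ be a map, and assume that: (a) $0 < D^-(I,a) \le D^+(I,a) < \infty$, (b) $(\mathcal{F},a)$ is $\ell^1$-localized with respect to its canonical dual frame sequence, and (c) $\mathcal{M}^+(\mathcal{F}) < 1$. Then there exists a subset $J \subset I$ such that $D^+(J,a) = D^-(J,a) > 0$ and $\{f_i\}_{i \in I \setminus J}$ is a frame for $\overline{\mathrm{span}}(\mathcal{F})$. Moreover, if $\mathcal{M}^+(\mathcal{F}) < \alpha < 1$ and $J_\alpha = \{i \in I : \langle f_i, \tilde f_i\rangle \le \alpha\}$, then for each $0 < \varepsilon < 1-\alpha$ there exists a subset $J \subset J_\alpha$ such that $D^+(J,a) = D^-(J,a) > 0$ and $\{f_i\}_{i \in I \setminus J}$ is a frame for $\overline{\mathrm{span}}(\mathcal{F})$ with frame bounds $A(1-\alpha-\varepsilon)$, $B$.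
   Context: $H$ is a separable Hilbert space and $I$ is a countable index set. $G = \prod_{i=1}^d a_i \mathbf{Z} \times \prod_{j=1}^e \mathbf{Z}_{n_j}$ (with $d \ge 1$, $a_i>0$, a countably infinite abelian group), equipped with $|g| = \sup\{|a_1 k_1|,\dots,|a_d k_d|,\delta(m_1),\dots,\delta(m_e)\}$ for $g=(a_1k_1,\dots,a_dk_d,m_1,\dots,m_e)$, where $\delta(0)=0$ and $\delta(m)=1$ for $m\neq 0$. For $N \in \mathbf{N}$ and $j\in G$ put $S_N(j) = \{k \in G : |k-j| \le N/2\}$ and $I_N(j) = a^{-1}(S_N(j))$. Densities: $D^-(I,a) = \liminf_{N\to\infty} \inf_{j\in G} |I_N(j)|/|S_N(j)|$ and $D^+(I,a) = \limsup_{N\to\infty} \sup_{j\in G} |I_N(j)|/|S_N(j)|$. For $J\subset I$, $D^\pm(J,a)$ means $D^\pm(J,a|_J)$, i.e. the same formulas with $I_N(j)$ replaced by $I_N(j)\cap J$. A frame sequence is a frame for its closed linear span (frame bounds $A,B>0$: $A\|f\|^2\le\sum_i|\langle f,f_i\rangle|^2\le B\|f\|^2$ for all $f$ in that span); $\{\tilde f_i\}_{i\in I}$ denotes its canonical dual frame within that span ($\tilde f_i = S^{-1}f_i$, $Sf=\sum_i\langle f,f_i\rangle f_i$ on the span). $(\mathcal{F},a)$ is $\ell^1$-localized with respect to its canonical dual frame sequence if there exists $r\in\ell^1(G)$ with $|\langle f_i,\tilde f_j\rangle|\le r_{a(i)-a(j)}$ for all $i,j\in I$. The upper measure is $$\mathcal{M}^+(\mathcal{F})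 = \limsup_{N\to\infty}\sup_{j\in G}\frac1{|I_N(j)|}\sum_{i\in I_N(j)}\langle f_i,\tilde f_i\rangle,$$ where an average over an empty set is read as $0$. *)

theory Defs
  imports "HOL-Analysis.Analysis" "HOL-Algebra.Product_Groups"
begin

section \<open>Hilbert spaces over the reals or the complex numbers\<close>

text \<open>
  The scalar field is kept generic, so that real and complex Hilbert spaces are treated at the
  same time. By the Gelfand--Mazur theorem a normed field over the reals with multiplicative norm
  is isomorphic to the reals or the complex numbers, and the axioms below then force \<open>cnjg\<close> and
  \<open>repart\<close> to be the conjugation and the real part.
\<close>

class real_or_complex = real_normed_field +
  fixes cnjg :: "'a \<Rightarrow> 'a" and repart :: "'a \<Rightarrow> real"
  assumes cnjg_add: "cnjg (x + y) = cnjg x + cnjg y"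
    and mult_cnjg: "x * cnjg x = (norm x)\<^sup>2 *\<^sub>R 1"
    and add_cnjg: "x + cnjg x = (2 * repart x) *\<^sub>R 1"

instantiation real :: real_or_complex
begin
definition "cnjg (x :: real) = x"
definition "repart (x :: real) = x"
instance
  by standard (simp_all add: cnjg_real_def repart_real_def power2_eq_square)
end

instantiation complex :: real_or_complex
begin
definition "cnjg (z :: complex) = cnj z"
definition "repart (z :: complex) = Re z"
instance
  by standard
    (simp_all add: cnjg_complex_def repart_complex_def scaleR_conv_of_real complex_add_cnj
      complex_norm_square[unfolded of_real_power])
end

text \<open>
  The norm of the ambient type is the norm of the inner product, which is linear in its first
  argument. A Hilbert space is such a structure on a type of class \<open>banach\<close>.
\<close>

locale inner_product_space = vector_space smul
  for smul :: "'k::real_or_complex \<Rightarrow> 'h::real_normed_vector \<Rightarrow> 'h" +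
  fixes ip :: "'h \<Rightarrow> 'h \<Rightarrow> 'k"
  assumes scale_of_real: "smul (of_real r) x = r *\<^sub>R x"
    and ip_add_left: "ip (x + y) z = ip x z + ip y z"
    and ip_scale_left: "ip (smul c x) z = c * ip x z"
    and ip_commute: "ip y x = cnjg (ip x y)"
    and ip_self: "ip x x = of_real ((norm x)\<^sup>2)"

lemma inner_product_space_real_inner:
  "inner_product_space scaleR (inner :: 'h::real_inner \<Rightarrow> 'h \<Rightarrow> real)"
  by unfold_locales
    (simp_all add: inner_add_left cnjg_real_def inner_commute power2_norm_eq_inner algebra_simps)

lemma inner_product_space_complex:
  "inner_product_space (*) (\<lambda>x y :: complex. x * cnj y)"
  by unfold_locales
    (simp_all add: cnjg_complex_def algebra_simps scaleR_conv_of_real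
      complex_norm_square[unfolded of_real_power])

section \<open>Frames\<close>

definition closed_span ::
    "('k::field \<Rightarrow> 'h::real_normed_vector \<Rightarrow> 'h) \<Rightarrow> 'h set \<Rightarrow> 'h set" where
  "closed_span smul X = closure (module.span smul X)"

text \<open>
  \<open>frame_bounds ip f I V A B\<close>: the family \<open>f\<close> indexed by \<open>I\<close> is a frame for \<open>V\<close> with (not
  necessarily optimal) bounds \<open>A\<close> and \<open>B\<close>. Summability is required explicitly, since \<open>infsum\<close>
  is \<open>0\<close> for families that are not summable.
\<close>

definition frame_bounds ::
    "('h \<Rightarrow> 'h \<Rightarrow> 'k::real_normed_field) \<Rightarrow> ('i \<Rightarrow> 'h) \<Rightarrow> 'i set \<Rightarrow>
      'h::real_normed_vector set \<Rightarrow> real \<Rightarrow> real \<Rightarrow> bool" where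
  "frame_bounds ip f I V A B \<longleftrightarrow>
     0 < A \<and> 0 < B \<and> f ` I \<subseteq> V \<and>
     (\<forall>x\<in>V. (\<lambda>i. (norm (ip x (f i)))\<^sup>2) summable_on I \<and>
        A * (norm x)\<^sup>2 \<le> (\<Sum>\<^sub>\<infinity>i\<in>I. (norm (ip x (f i)))\<^sup>2) \<and>
        (\<Sum>\<^sub>\<infinity>i\<in>I. (norm (ip x (f i)))\<^sup>2) \<le> B * (norm x)\<^sup>2)"

definition is_frame ::
    "('h \<Rightarrow> 'h \<Rightarrow> 'k::real_normed_field) \<Rightarrow> ('i \<Rightarrow> 'h) \<Rightarrow> 'i set \<Rightarrow>
      'h::real_normed_vector set \<Rightarrow> bool" where
  "is_frame ip f I V \<longleftrightarrow> (\<exists>A B. frame_bounds ip f I V A B)"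

definition frame_operator ::
    "('k \<Rightarrow> 'h \<Rightarrow> 'h) \<Rightarrow> ('h \<Rightarrow> 'h \<Rightarrow> 'k) \<Rightarrow> ('i \<Rightarrow> 'h) \<Rightarrow> 'i set \<Rightarrow>
      'h::real_normed_vector \<Rightarrow> 'h" where
  "frame_operator smul ip f I x = (\<Sum>\<^sub>\<infinity>i\<in>I. smul (ip x (f i)) (f i))"

text \<open>
  For a frame sequence the frame operator is a bijection of the closed span onto itself;
  \<open>inv_into\<close> is its inverse there.
\<close>

definition canonical_dual ::
    "('k::field \<Rightarrow> 'h \<Rightarrow> 'h) \<Rightarrow> ('h \<Rightarrow> 'h \<Rightarrow> 'k) \<Rightarrow> ('i \<Rightarrow> 'h) \<Rightarrow> 'i set \<Rightarrow>
      'i \<Rightarrow> 'h::real_normed_vector" where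
  "canonical_dual smul ip f I i =
     inv_into (closed_span smul (f ` I)) (frame_operator smul ip f I) (f i)"

section \<open>The index group\<close>

definition lattice_group :: "real \<Rightarrow> real monoid" where
  "lattice_group s =
     \<lparr>carrier = range (\<lambda>k::int. s * of_int k), monoid.mult = (+), one = 0\<rparr>"

text \<open>
  The group is written multiplicatively, following \<open>HOL-Algebra\<close>; thus the difference
  \<open>g - h\<close> is \<open>g \<otimes> inv h\<close>.
\<close>

definition index_group ::
    "nat \<Rightarrow> (nat \<Rightarrow> real) \<Rightarrow> nat \<Rightarrow> (nat \<Rightarrow> nat) \<Rightarrow> ((nat \<Rightarrow> real) \<times> (nat \<Rightarrow> int)) monoid" where
  "index_group d s e n =
     product_group {..<d} (\<lambda>i. lattice_group (s i)) \<times>\<times>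
     product_group {..<e} (\<lambda>j. integer_mod_group (n j))"

definition index_length :: "nat \<Rightarrow> nat \<Rightarrow> (nat \<Rightarrow> real) \<times> (nat \<Rightarrow> int) \<Rightarrow> real" where
  "index_length d e g =
     Max ((\<lambda>i. \<bar>fst g i\<bar>) ` {..<d} \<union> (\<lambda>j. if snd g j = 0 then 0 else 1) ` {..<e})"

section \<open>Density, localization and measure\<close>

definition window :: "('g, 'm) monoid_scheme \<Rightarrow> ('g \<Rightarrow> real) \<Rightarrow> nat \<Rightarrow> 'g \<Rightarrow> 'g set" where
  "window G len N j =
     {k \<in> carrier G. len (k \<otimes>\<^bsub>G\<^esub> inv\<^bsub>G\<^esub> j) \<le> real N / 2}"

definition index_window ::
    "('g, 'm) monoid_scheme \<Rightarrow> ('g \<Rightarrow> real) \<Rightarrow> 'i set \<Rightarrow> ('i \<Rightarrow> 'g) \<Rightarrow> nat \<Rightarrow> 'g \<Rightarrow> 'i set" where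
  "index_window G len I a N j = {i \<in> I. a i \<in> window G len N j}"

text \<open>
  The sets \<open>index_window G len I a N j\<close> may be infinite, whence the counting measure instead of
  \<open>card\<close>, which is \<open>0\<close> on infinite sets.
\<close>

definition density_ratio ::
    "('g, 'm) monoid_scheme \<Rightarrow> ('g \<Rightarrow> real) \<Rightarrow> 'i set \<Rightarrow> ('i \<Rightarrow> 'g) \<Rightarrow> nat \<Rightarrow> 'g \<Rightarrow> ennreal" where
  "density_ratio G len I a N j =
     emeasure (count_space UNIV) (index_window G len I a N j) / of_nat (card (window G len N j))"

definition lower_density ::
    "('g, 'm) monoid_scheme \<Rightarrow> ('g \<Rightarrow> real) \<Rightarrow> 'i set \<Rightarrow> ('i \<Rightarrow> 'g) \<Rightarrow> ennreal" where
  "lower_density G len I a = liminf (\<lambda>N. INF j\<in>carrier G. density_ratio G len I a N j)"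

definition upper_density ::
    "('g, 'm) monoid_scheme \<Rightarrow> ('g \<Rightarrow> real) \<Rightarrow> 'i set \<Rightarrow> ('i \<Rightarrow> 'g) \<Rightarrow> ennreal" where
  "upper_density G len I a = limsup (\<lambda>N. SUP j\<in>carrier G. density_ratio G len I a N j)"

definition l1_localized ::
    "('g, 'm) monoid_scheme \<Rightarrow> ('h \<Rightarrow> 'h \<Rightarrow> 'k::real_normed_field) \<Rightarrow> ('i \<Rightarrow> 'h) \<Rightarrow> ('i \<Rightarrow> 'h) \<Rightarrow>
      'i set \<Rightarrow> ('i \<Rightarrow> 'g) \<Rightarrow> bool" where
  "l1_localized G ip f f' I a \<longleftrightarrow>
     (\<exists>r :: 'g \<Rightarrow> real. (\<lambda>g. norm (r g)) summable_on carrier G \<and>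
        (\<forall>i\<in>I. \<forall>j\<in>I. norm (ip (f i) (f' j)) \<le> r (a i \<otimes>\<^bsub>G\<^esub> inv\<^bsub>G\<^esub> (a j))))"

text \<open>
  The numbers \<open>ip (f i) (f' i)\<close> are real when \<open>f'\<close> is the canonical dual of \<open>f\<close>; \<open>repart\<close> only
  changes their type. The average over an empty window is \<open>0\<close> because \<open>1 / 0 = 0\<close>. Infinite windows
  have the same value here, but they do not occur for large \<open>N\<close> when the upper density is finite.
\<close>

definition upper_measure ::
    "('g, 'm) monoid_scheme \<Rightarrow> ('g \<Rightarrow> real) \<Rightarrow> ('h \<Rightarrow> 'h \<Rightarrow> 'k::real_or_complex) \<Rightarrow>
      ('i \<Rightarrow> 'h) \<Rightarrow> ('i \<Rightarrow> 'h) \<Rightarrow> 'i set \<Rightarrow> ('i \<Rightarrow> 'g) \<Rightarrow> ereal" where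
  "upper_measure G len ip f f' I a =
     limsup (\<lambda>N. SUP j\<in>carrier G.
       ereal (1 / real (card (index_window G len I a N j)) *
         (\<Sum>i\<in>index_window G len I a N j. repart (ip (f i) (f' i)))))"

end

theory Submission
  imports Defs "HOL-Real_Asymp.Real_Asymp"
begin

text \<open>
The proof rests on an exact description of what removing a subset \<open>J\<close> costs. Write \<open>S\<close> for the
frame operator on the closed span and \<open>Q(x) = \<langle>S x, x\<rangle>\<close>, the sum of the \<open>|\<langle>x, f\<^sub>i\<rangle>|\<^sup>2\<close>. The matrix of
all \<open>\<langle>f\<^sub>i, S\<inverse> f\<^sub>j\<rangle>\<close> is the Gram matrix of the canonical tight frame \<open>S\<^sup>-\<^sup>1\<^sup>/\<^sup>2 f\<^sub>i\<close>; if its block on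
\<open>J\<close> has norm at most \<open>\<beta> < 1\<close>, then the elements of \<open>J\<close> carry at most the fraction \<open>\<beta>\<close> of \<open>Q(x)\<close>, and
what is left is still a frame with lower bound \<open>A (1 - \<beta>)\<close>. No square root of \<open>S\<close> is used for this: for
a finite \<open>F \<subseteq> J\<close> put \<open>y = \<Sum>\<^bsub>i\<in>F\<^esub> \<langle>x, f\<^sub>i\<rangle> S\<inverse> f\<^sub>i\<close>. With \<open>m\<close> the sum of \<open>|\<langle>x, f\<^sub>i\<rangle>|\<^sup>2\<close> over \<open>F\<close> one has
\<open>\<langle>S y, x\<rangle> = m\<close> and \<open>Q(y) \<le> \<beta> m\<close>, so that \<open>0 \<le> Q(x - y/\<beta>) \<le> Q(x) - m/\<beta>\<close>. This is
\<open>frame_bounds_remove\<close>.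

The norm of the block is estimated by Schur's test. The diagonal entries are at most \<open>\<alpha>\<close> once \<open>J\<close> is a
subset of \<open>J\<^sub>\<alpha>\<close>. The off-diagonal entries are dominated by \<open>r (a i - a j)\<close> with \<open>r\<close> summable, hence
their row and column sums over \<open>J\<close> are at most \<open>\<epsilon>\<close> as soon as the points \<open>a i\<close>, \<open>i \<in> J\<close>, are far
enough apart (\<open>small_off_diagonal\<close>).

It remains to find a separated \<open>J \<subseteq> J\<^sub>\<alpha>\<close> whose upper and lower densities agree and are positive. An
average below \<open>\<alpha>\<close> over a finite nonempty window forces some term of the window to be at most \<open>\<alpha>\<close>; so
the assumptions on the densities and on the upper measure provide one size \<open>N\<close> for which every window
contains a point of \<open>J\<^sub>\<alpha>\<close> (\<open>windows_meet_sublevel_set\<close>). Now tile the group by boxes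
of equal cardinality \<open>q\<close> around a very sparse sublattice and pick for every lattice point an element of
\<open>J\<^sub>\<alpha>\<close> within distance \<open>N/2\<close>. The points so chosen are separated, and each accounts for one box up to a
bounded displacement. Since enlarging the radius of a window by a constant changes its cardinality by
a factor tending to \<open>1\<close>, both densities are equal to \<open>1/q\<close> (\<open>density_tiled\<close>).

The combinatorial part needs only a group with a length, this growth property and such tilings; these
are collected in the locale \<open>tiled_length_group\<close> and verified for the index group in \<open>tiled_length_group_G\<close>.
\<close>

section \<open>Unconditional sums\<close>

lemma summable_on_small_tail:
  fixes g :: "'i \<Rightarrow> real"
  assumes "g summable_on I" and nonneg: "\<And>i. i \<in> I \<Longrightarrow> 0 \<le> g i" and "0 < \<delta>"
  obtains F where "finite F" "F \<subseteq> I"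
    "\<And>E. finite E \<Longrightarrow> E \<subseteq> I - F \<Longrightarrow> sum g E < \<delta>"
proof -
  have "(sum g \<longlongrightarrow> infsum g I) (finite_subsets_at_top I)"
    using assms(1) by (rule infsum_tendsto)
  then have "eventually (\<lambda>F. dist (sum g F) (infsum g I) < \<delta>) (finite_subsets_at_top I)"
    using \<open>0 < \<delta>\<close> by (simp add: tendsto_iff)
  then obtain F where F: "finite F" "F \<subseteq> I"
    "\<And>E. finite E \<Longrightarrow> F \<subseteq> E \<Longrightarrow> E \<subseteq> I \<Longrightarrow> dist (sum g E) (infsum g I) < \<delta>"
    unfolding eventually_finite_subsets_at_top by auto
  have "sum g E < \<delta>" if E: "finite E" "E \<subseteq> I - F" for E
  proof -
    have "sum g F + sum g E = sum g (F \<union> E)"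
      using E F by (subst sum.union_disjoint) auto
    also have "\<dots> \<le> infsum g I"
      by (rule finite_sum_le_infsum) (use assms E F in auto)
    finally show ?thesis
      using F(3)[OF F(1) order_refl F(2)] by (simp add: dist_real_def)
  qed
  with F show thesis using that by blast
qed

text \<open>
The substitute for absolute convergence in the construction of the frame operator: the series
\<open>\<Sum> \<langle>x, f\<^sub>i\<rangle> f\<^sub>i\<close> need not converge absolutely, but its finite blocks are controlled by blocks of a
summable series of squares, so the partial sums form a Cauchy net.
\<close>

lemma summable_on_if_square_norm_dominated:
  fixes f :: "'i \<Rightarrow> 'h::banach" and g :: "'i \<Rightarrow> real"
  assumes "g summable_on I" and nonneg: "\<And>i. i \<in> I \<Longrightarrow> 0 \<le> g i" and "0 < C"
    and bound: "\<And>F. finite F \<Longrightarrow> F \<subseteq> I \<Longrightarrow> (norm (sum f F))\<^sup>2 \<le> C * sum g F"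
  shows "f summable_on I"
proof -
  have "cauchy_filter (filtermap (sum f) (finite_subsets_at_top I))"
    unfolding cauchy_filter_metric_filtermap
  proof (intro allI impI)
    fix \<delta> :: real assume \<delta>: "0 < \<delta>"
    have "0 < (\<delta>/2)\<^sup>2 / C"
      using \<delta> \<open>0 < C\<close> by simp
    then obtain F where F: "finite F" "F \<subseteq> I"
      and tail: "\<And>E. finite E \<Longrightarrow> E \<subseteq> I - F \<Longrightarrow> sum g E < (\<delta>/2)\<^sup>2 / C"
      using summable_on_small_tail[OF assms(1) nonneg] by metis
    have half: "dist (sum f E) (sum f F) < \<delta>/2" if "finite E" "F \<subseteq> E" "E \<subseteq> I" for E
    proof -
      have "(norm (sum f (E - F)))\<^sup>2 \<le> C * sum g (E - F)"
        using that by (intro bound) auto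
      also have "\<dots> < (\<delta>/2)\<^sup>2"
        using tail[of "E - F"] that \<open>0 < C\<close> by (auto simp: field_simps)
      finally have "norm (sum f (E - F)) < \<delta>/2"
        using \<delta> power2_less_imp_less by fastforce
      moreover have "sum f (E - F) = sum f E - sum f F"
        using that F by (simp add: sum_diff)
      ultimately show ?thesis
        by (simp add: dist_norm)
    qed
    let ?P = "\<lambda>E. finite E \<and> F \<subseteq> E \<and> E \<subseteq> I"
    have "eventually ?P (finite_subsets_at_top I)"
      unfolding eventually_finite_subsets_at_top using F by blast
    moreover have "dist (sum f E) (sum f E') < \<delta>" if "?P E \<and> ?P E'" for E E'
      using half[of E] half[of E'] that dist_triangle_half_l by blast
    ultimately show "\<exists>P. eventually P (finite_subsets_at_top I) \<and>
        (\<forall>E E'. P E \<and> P E' \<longrightarrow> dist (sum f E) (sum f E') < \<delta>)"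
      by blast
  qed
  then obtain L where "(sum f \<longlongrightarrow> L) (finite_subsets_at_top I)"
    using complete_uniform[where S = "UNIV :: 'h set"] complete_UNIV
    by (force simp: filterlim_def)
  then show ?thesis
    using summable_on_def has_sum_def by blast
qed

section \<open>Conjugation\<close>

text \<open>
This formula makes the conjugation multiplicative, isometric and involutive; the class axioms state
only its additivity and two identities.
\<close>

lemma cnjg_eq_divide:
  fixes x :: "'k::real_or_complex"
  assumes "x \<noteq> 0"
  shows "cnjg x = of_real ((norm x)\<^sup>2) / x"
  using mult_cnjg[of x] assms by (simp add: field_simps scaleR_conv_of_real)

lemma cnjg_zero [simp]: "cnjg (0::'k::real_or_complex) = 0"
  using cnjg_add[of "0::'k" 0] by simp

lemma cnjg_mult: "cnjg (x * y) = cnjg x * cnjg (y::'k::real_or_complex)"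
  by (cases "x = 0"; cases "y = 0") (simp_all add: cnjg_eq_divide norm_mult power_mult_distrib)

lemma norm_cnjg [simp]: "norm (cnjg x) = norm (x::'k::real_or_complex)"
  by (cases "x = 0") (simp_all add: cnjg_eq_divide norm_divide norm_mult power2_eq_square)

lemma cnjg_cnjg [simp]: "cnjg (cnjg x) = (x::'k::real_or_complex)"
proof (cases "x = 0")
  case False
  then have "cnjg x \<noteq> 0"
    using norm_cnjg[of x] by (metis norm_eq_zero)
  then show ?thesis
    using False by (simp add: cnjg_eq_divide[of "cnjg x"]) (simp add: cnjg_eq_divide)
qed simp

lemma cnjg_of_real [simp]: "cnjg (of_real r) = (of_real r :: 'k::real_or_complex)"
  by (cases "r = 0") (simp_all add: cnjg_eq_divide power2_eq_square flip: of_real_mult of_real_divide)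

lemma repart_of_real [simp]: "repart (of_real r :: 'k::real_or_complex) = r"
proof -
  have "(of_real (2 * r) :: 'k) = of_real (2 * repart (of_real r :: 'k))"
    using add_cnjg[of "of_real r :: 'k"] by (simp add: scaleR_conv_of_real flip: of_real_add)
  then show ?thesis
    by (simp only: of_real_eq_iff)
qed

lemma bounded_linear_cnjg: "bounded_linear (cnjg :: 'k::real_or_complex \<Rightarrow> 'k)"
proof (rule bounded_linear_intro[where K = 1])
  show "cnjg (r *\<^sub>R x) = r *\<^sub>R cnjg x" for r and x :: 'k
    by (simp add: scaleR_conv_of_real cnjg_mult)
qed (simp_all add: cnjg_add)

section \<open>Inner products\<close>

context inner_product_space
begin

lemma ip_add_right: "ip x (y + z) = ip x y + ip x z"
  by (metis cnjg_add ip_add_left ip_commute)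

lemma ip_scale_right: "ip x (smul c y) = cnjg c * ip x y"
  by (metis cnjg_mult ip_scale_left ip_commute)

lemma ip_scaleR_left: "ip (r *\<^sub>R x) y = of_real r * ip x y"
  by (metis ip_scale_left scale_of_real)

lemma ip_scaleR_right: "ip x (r *\<^sub>R y) = of_real r * ip x y"
  by (metis ip_scale_right scale_of_real cnjg_of_real)

lemma ip_zero_left [simp]: "ip 0 y = 0"
  using ip_add_left[of 0 0 y] by simp

lemma ip_zero_right [simp]: "ip x 0 = 0"
  using ip_add_right[of x 0 0] by simp

lemma ip_minus_left: "ip (- x) y = - ip x y"
  using ip_add_left[of x "- x" y] by (simp add: eq_neg_iff_add_eq_0 add.commute)

lemma ip_diff_left: "ip (x - y) z = ip x z - ip y z"
  using ip_add_left[of x "- y" z] by (simp add: ip_minus_left)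

lemma ip_diff_right: "ip x (y - z) = ip x y - ip x z"
  by (metis add_diff_cancel_right' diff_add_cancel ip_add_right)

lemma ip_sum_left: "ip (sum f F) y = (\<Sum>i\<in>F. ip (f i) y)"
  by (induction F rule: infinite_finite_induct) (simp_all add: ip_add_left)

lemma ip_sum_right: "ip x (sum f F) = (\<Sum>i\<in>F. ip x (f i))"
  by (induction F rule: infinite_finite_induct) (simp_all add: ip_add_right)

lemma norm_ip_commute: "norm (ip y x) = norm (ip x y)"
  by (metis ip_commute norm_cnjg)

lemma ip_mult_swap: "ip x y * ip y x = of_real ((norm (ip x y))\<^sup>2)"
  using mult_cnjg[of "ip x y"] by (simp add: ip_commute[of y x] scaleR_conv_of_real)

lemma norm_smul: "norm (smul c x) = norm c * norm x"
proof -
  have "(of_real ((norm (smul c x))\<^sup>2) :: 'k) = of_real ((norm c * norm x)\<^sup>2)"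
    unfolding ip_self[symmetric] power_mult_distrib of_real_mult
    by (simp add: ip_scale_left ip_scale_right mult_cnjg[of c, unfolded scaleR_conv_of_real]
        mult.commute[of "cnjg c" c] flip: mult.assoc)
  then have "(norm (smul c x))\<^sup>2 = (norm c * norm x)\<^sup>2"
    by (simp only: of_real_eq_iff)
  then show ?thesis
    by (simp add: power2_eq_iff_nonneg)
qed

text \<open>
The Cauchy--Schwarz inequality, from the projection \<open>c y\<close> of \<open>x\<close> to the line through \<open>y\<close>, where
\<open>c = \<langle>x, y\<rangle> / |y|\<^sup>2\<close>: the square \<open>|x - c y|\<^sup>2 = |x|\<^sup>2 - |\<langle>x, y\<rangle>|\<^sup>2 / |y|\<^sup>2\<close> is not negative.
\<close>

lemma norm_ip_le: "norm (ip x y) \<le> norm x * norm y"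
proof (cases "y = 0")
  case False
  define m where "m = norm (ip x y)"
  define c where "c = ip x y / of_real ((norm y)\<^sup>2)"
  have ny: "(of_real ((norm y)\<^sup>2) :: 'k) \<noteq> 0"
    using False by simp
  have cn: "cnjg c = ip y x / of_real ((norm y)\<^sup>2)"
    unfolding c_def ip_commute[of y x]
    by (metis (no_types) cnjg_mult cnjg_of_real divide_inverse of_real_inverse)
  have "(of_real ((norm (x - smul c y))\<^sup>2) :: 'k)
      = ip x x - cnjg c * ip x y - c * ip y x + c * (cnjg c * ip y y)"
    unfolding ip_self[symmetric]
    by (simp add: ip_diff_left ip_diff_right ip_scale_left ip_scale_right algebra_simps)
  also have "\<dots> = of_real ((norm x)\<^sup>2) - (ip x y * ip y x) / of_real ((norm y)\<^sup>2)"
    using ny unfolding cn c_def ip_self by (simp add: field_simps)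
  also have "\<dots> = of_real ((norm x)\<^sup>2 - m\<^sup>2 / (norm y)\<^sup>2)"
    by (simp add: ip_mult_swap m_def)
  finally have "(norm (x - smul c y))\<^sup>2 = (norm x)\<^sup>2 - m\<^sup>2 / (norm y)\<^sup>2"
    by (simp only: of_real_eq_iff)
  then have "m\<^sup>2 / (norm y)\<^sup>2 \<le> (norm x)\<^sup>2"
    by (metis diff_ge_0_iff_ge zero_le_power2)
  then have "m\<^sup>2 \<le> (norm x * norm y)\<^sup>2"
    using False by (simp add: field_simps)
  then show ?thesis
    unfolding m_def by (rule power2_le_imp_le) simp
qed simp

lemma bounded_linear_ip_left: "bounded_linear (\<lambda>x. ip x y)"
proof (rule bounded_linear_intro)
  show "ip (r *\<^sub>R x) y = r *\<^sub>R ip x y" for r x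
    by (simp add: ip_scaleR_left scaleR_conv_of_real)
  show "norm (ip x y) \<le> norm x * norm y" for x
    by (rule norm_ip_le)
qed (rule ip_add_left)

lemma bounded_linear_smul: "bounded_linear (smul c)"
proof (rule bounded_linear_intro)
  show "smul c (r *\<^sub>R x) = r *\<^sub>R smul c x" for r x
    by (metis scale_left_commute scale_of_real)
  show "norm (smul c x) \<le> norm x * norm c" for x
    by (simp add: norm_smul)
qed (auto simp: scale_right_distrib)

lemma norm_diff_square:
  assumes m: "ip y x = of_real m"
  shows "(norm (x - t *\<^sub>R y))\<^sup>2 = (norm x)\<^sup>2 - 2 * t * m + t\<^sup>2 * (norm y)\<^sup>2"
proof -
  have m': "ip x y = of_real m"
    using m ip_commute[of x y] by simp
  have "(of_real ((norm (x - t *\<^sub>R y))\<^sup>2) :: 'k)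
      = ip x x - of_real t * ip x y - of_real t * ip y x + of_real t * (of_real t * ip y y)"
    unfolding ip_self[symmetric]
    by (simp add: ip_diff_left ip_diff_right ip_scaleR_left ip_scaleR_right algebra_simps)
  also have "\<dots> = of_real ((norm x)\<^sup>2 - 2 * t * m + t\<^sup>2 * (norm y)\<^sup>2)"
    by (simp add: ip_self m m' power2_eq_square)
  finally show ?thesis
    by (simp only: of_real_eq_iff)
qed

lemma closed_span_superset: "X \<subseteq> closed_span smul X"
  unfolding closed_span_def using span_superset[of X] closure_subset[of "span X"] by blast

lemma closed_span_zero: "0 \<in> closed_span smul X"
  unfolding closed_span_def using closure_subset[of "span X"] span_zero[of X] by blast

lemma closed_span_add:
  assumes "x \<in> closed_span smul X" "y \<in> closed_span smul X"
  shows "x + y \<in> closed_span smul X"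
proof -
  obtain u v where uv: "\<And>n. u n \<in> span X" "u \<longlonglongrightarrow> x" "\<And>n. v n \<in> span X" "v \<longlonglongrightarrow> y"
    using assms unfolding closed_span_def closure_sequential by blast
  then have "\<And>n. u n + v n \<in> span X" "(\<lambda>n. u n + v n) \<longlonglongrightarrow> x + y"
    by (auto intro: span_add tendsto_add)
  then show ?thesis
    unfolding closed_span_def closure_sequential by (intro exI[of _ "\<lambda>n. u n + v n"]) auto
qed

lemma closed_span_scale:
  assumes "x \<in> closed_span smul X"
  shows "smul c x \<in> closed_span smul X"
proof -
  obtain u where u: "\<And>n. u n \<in> span X" "u \<longlonglongrightarrow> x"
    using assms unfolding closed_span_def closure_sequential by blast
  then have "\<And>n. smul c (u n) \<in> span X" "(\<lambda>n. smul c (u n)) \<longlonglongrightarrow> smul c x"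
    by (auto intro: span_scale bounded_linear.tendsto[OF bounded_linear_smul])
  then show ?thesis
    unfolding closed_span_def closure_sequential by (intro exI[of _ "\<lambda>n. smul c (u n)"]) auto
qed

end

section \<open>The frame operator\<close>

lemma infsum_bounded_linear_image:
  assumes "bounded_linear h" "g summable_on I"
  shows "(\<Sum>\<^sub>\<infinity>i\<in>I. h (g i)) = h (infsum g I)"
  by (rule infsumI[OF has_sum_bounded_linear[OF assms(1) has_sum_infsum[OF assms(2)]]])

locale frame_sequence = inner_product_space smul ip
  for smul :: "'k::real_or_complex \<Rightarrow> 'h::banach \<Rightarrow> 'h" and ip +
  fixes f :: "'i \<Rightarrow> 'h" and I :: "'i set" and A B :: real
  assumes frame: "frame_bounds ip f I (closed_span smul (f ` I)) A B"
begin

abbreviation V :: "'h set" where "V \<equiv> closed_span smul (f ` I)"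

abbreviation S :: "'h \<Rightarrow> 'h" where "S \<equiv> frame_operator smul ip f I"

text \<open>
The quadratic form \<open>\<langle>S x, x\<rangle>\<close> of the frame operator, see \<open>ip_S_self\<close>. Defined as a sum, it is also the
quantity that the frame inequalities bound.
\<close>

definition energy :: "'h \<Rightarrow> real" where
  "energy x = (\<Sum>\<^sub>\<infinity>i\<in>I. (norm (ip x (f i)))\<^sup>2)"

lemma A_pos: "0 < A" and B_pos: "0 < B"
  using frame by (auto simp: frame_bounds_def)

lemma energy_summable: "x \<in> V \<Longrightarrow> (\<lambda>i. (norm (ip x (f i)))\<^sup>2) summable_on I"
  using frame by (auto simp: frame_bounds_def)

lemma energy_lower: "x \<in> V \<Longrightarrow> A * (norm x)\<^sup>2 \<le> energy x"
  using frame by (auto simp: frame_bounds_def energy_def)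

lemma energy_upper: "x \<in> V \<Longrightarrow> energy x \<le> B * (norm x)\<^sup>2"
  using frame by (auto simp: frame_bounds_def energy_def)

lemma energy_nonneg: "0 \<le> energy x"
  unfolding energy_def by (rule infsum_nonneg) simp

lemma partial_energy_le:
  assumes "x \<in> V" "finite F" "F \<subseteq> I"
  shows "(\<Sum>i\<in>F. (norm (ip x (f i)))\<^sup>2) \<le> energy x"
  unfolding energy_def by (rule finite_sum_le_infsum) (use assms energy_summable in auto)

lemma f_in_V: "i \<in> I \<Longrightarrow> f i \<in> V"
  using closed_span_superset by blast

lemma V_scaleR: "x \<in> V \<Longrightarrow> r *\<^sub>R x \<in> V"
  by (metis closed_span_scale scale_of_real)

lemma V_diff: "x \<in> V \<Longrightarrow> y \<in> V \<Longrightarrow> x - y \<in> V"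
  using closed_span_add[of x _ "(-1) *\<^sub>R y"] V_scaleR[of y "-1"] by simp

lemma V_sum: "(\<And>i. i \<in> F \<Longrightarrow> g i \<in> V) \<Longrightarrow> sum g F \<in> V"
  by (induction F rule: infinite_finite_induct) (auto simp: closed_span_zero closed_span_add)

text \<open>
The synthesis operator is the adjoint of the analysis operator and has the same bound. For the
finite sum \<open>y\<close> this is seen from \<open>|y|\<^sup>2 = \<Sum> c\<^sub>i \<langle>f\<^sub>i, y\<rangle>\<close>, by Cauchy--Schwarz and the upper frame
inequality for \<open>y\<close>.
\<close>

lemma synthesis_bound:
  assumes F: "finite F" "F \<subseteq> I"
  shows "(norm (\<Sum>i\<in>F. smul (c i) (f i)))\<^sup>2 \<le> B * (\<Sum>i\<in>F. (norm (c i))\<^sup>2)"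
proof -
  define y where "y = (\<Sum>i\<in>F. smul (c i) (f i))"
  define C where "C = (\<Sum>i\<in>F. (norm (c i))\<^sup>2)"
  have y: "y \<in> V"
    unfolding y_def using F by (intro V_sum closed_span_scale f_in_V) auto
  have C: "0 \<le> C"
    unfolding C_def by (simp add: sum_nonneg)
  have "(norm y)\<^sup>2 = norm (ip y y)"
    by (simp add: ip_self norm_power)
  also have "ip y y = (\<Sum>i\<in>F. c i * ip (f i) y)"
    by (subst (1) y_def) (simp add: ip_sum_left ip_scale_left)
  also have "norm \<dots> \<le> (\<Sum>i\<in>F. norm (c i) * norm (ip y (f i)))"
    by (rule order_trans[OF norm_sum]) (simp add: norm_mult norm_ip_commute[of y])
  finally have "((norm y)\<^sup>2)\<^sup>2 \<le> (\<Sum>i\<in>F. norm (c i) * norm (ip y (f i)))\<^sup>2"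
    by (intro power_mono) auto
  also have "\<dots> \<le> C * (\<Sum>i\<in>F. (norm (ip y (f i)))\<^sup>2)"
    unfolding C_def by (rule Cauchy_Schwarz_ineq_sum)
  also have "\<dots> \<le> C * (B * (norm y)\<^sup>2)"
    using partial_energy_le[OF y F] energy_upper[OF y] C by (intro mult_left_mono) auto
  finally have *: "(norm y)\<^sup>2 * (norm y)\<^sup>2 \<le> (B * C) * (norm y)\<^sup>2"
    by (simp add: power2_eq_square mult_ac)
  have "(norm y)\<^sup>2 \<le> B * C"
  proof (cases "y = 0")
    case True
    then show ?thesis using C B_pos by simp
  next
    case False
    then have "0 < (norm y)\<^sup>2" by simp
    with * show ?thesis by (rule mult_right_le_imp_le)
  qed
  then show ?thesis
    by (simp add: y_def C_def)
qed

lemma S_summable: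
  assumes "x \<in> V"
  shows "(\<lambda>i. smul (ip x (f i)) (f i)) summable_on I"
  by (rule summable_on_if_square_norm_dominated[OF energy_summable[OF assms] _ B_pos])
    (simp_all add: synthesis_bound)

lemma S_tendsto:
  assumes "x \<in> V"
  shows "((\<lambda>F. \<Sum>i\<in>F. smul (ip x (f i)) (f i)) \<longlongrightarrow> S x) (finite_subsets_at_top I)"
  unfolding frame_operator_def using S_summable[OF assms] by (rule infsum_tendsto)

lemma S_in_V:
  assumes "x \<in> V"
  shows "S x \<in> V"
proof (rule Lim_in_closed_set[OF _ _ _ S_tendsto[OF assms]])
  show "closed V"
    by (simp add: closed_span_def)
  show "\<forall>\<^sub>F F in finite_subsets_at_top I. (\<Sum>i\<in>F. smul (ip x (f i)) (f i)) \<in> V"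
    by (rule eventually_finite_subsets_at_top_weakI)
      (auto intro!: V_sum closed_span_scale f_in_V)
qed simp

lemma norm_S_le:
  assumes "x \<in> V"
  shows "(norm (S x))\<^sup>2 \<le> B * energy x"
proof (rule tendsto_upperbound)
  show "((\<lambda>F. (norm (\<Sum>i\<in>F. smul (ip x (f i)) (f i)))\<^sup>2) \<longlongrightarrow> (norm (S x))\<^sup>2)
      (finite_subsets_at_top I)"
    by (intro tendsto_intros S_tendsto[OF assms])
  show "\<forall>\<^sub>F F in finite_subsets_at_top I.
      (norm (\<Sum>i\<in>F. smul (ip x (f i)) (f i)))\<^sup>2 \<le> B * energy x"
    by (rule eventually_finite_subsets_at_top_weakI)
      (use assms B_pos in \<open>auto intro!: order_trans[OF synthesis_bound] mult_left_mono
        partial_energy_le\<close>)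
qed simp

lemma ip_S_left:
  assumes "x \<in> V"
  shows "ip (S x) y = (\<Sum>\<^sub>\<infinity>i\<in>I. ip x (f i) * ip (f i) y)"
    and "(\<lambda>i. ip x (f i) * ip (f i) y) summable_on I"
  unfolding frame_operator_def ip_scale_left[symmetric]
  by (rule infsum_bounded_linear_image[OF bounded_linear_ip_left S_summable[OF assms], symmetric],
      rule summable_on_bounded_linear[OF bounded_linear_ip_left S_summable[OF assms]])

lemma ip_S_self:
  assumes "x \<in> V"
  shows "ip (S x) x = of_real (energy x)"
  unfolding ip_S_left(1)[OF assms] ip_mult_swap energy_def
  by (rule infsum_bounded_linear_image[OF bounded_linear_of_real energy_summable[OF assms]])

lemma S_adjoint:
  assumes "x \<in> V" "y \<in> V"
  shows "ip (S x) y = ip x (S y)"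
proof -
  have "ip x (S y) = cnjg (ip (S y) x)"
    by (rule ip_commute)
  also have "\<dots> = (\<Sum>\<^sub>\<infinity>i\<in>I. cnjg (ip y (f i) * ip (f i) x))"
    unfolding ip_S_left(1)[OF assms(2)]
    by (rule infsum_bounded_linear_image[OF bounded_linear_cnjg ip_S_left(2)[OF assms(2)], symmetric])
  also have "\<dots> = (\<Sum>\<^sub>\<infinity>i\<in>I. ip x (f i) * ip (f i) y)"
    by (rule infsum_cong) (simp add: cnjg_mult mult.commute flip: ip_commute)
  finally show ?thesis
    by (simp add: ip_S_left(1)[OF assms(1)])
qed

lemma S_add: "x \<in> V \<Longrightarrow> y \<in> V \<Longrightarrow> S (x + y) = S x + S y"
  unfolding frame_operator_def
  by (subst infsum_add[symmetric]) (auto simp: S_summable ip_add_left scale_left_distrib)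

lemma S_scale: "x \<in> V \<Longrightarrow> S (smul c x) = smul c (S x)"
  unfolding frame_operator_def
  by (subst infsum_bounded_linear_image[OF bounded_linear_smul, symmetric])
    (auto simp: S_summable ip_scale_left)

lemma S_scaleR: "x \<in> V \<Longrightarrow> S (r *\<^sub>R x) = r *\<^sub>R S x"
  using S_scale[of x "of_real r"] by (simp add: scale_of_real)

lemma S_diff: "x \<in> V \<Longrightarrow> y \<in> V \<Longrightarrow> S (x - y) = S x - S y"
  using S_add[of x "(-1) *\<^sub>R y"] V_scaleR[of y "-1"] S_scaleR[of y "-1"] by simp

lemma S_sum: "(\<And>i. i \<in> F \<Longrightarrow> g i \<in> V) \<Longrightarrow> S (sum g F) = (\<Sum>i\<in>F. S (g i))"
proof (induction F rule: infinite_finite_induct)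
  case (insert i F)
  then show ?case by (simp add: S_add V_sum)
qed (simp_all add: frame_operator_def)

text \<open>
The contraction estimate behind the invertibility of \<open>S\<close>. With the step \<open>1 / B\<close> the quadratic term
\<open>|S x|\<^sup>2 / B\<^sup>2\<close> takes back at most one half of the linear term \<open>2 \<langle>S x, x\<rangle> / B\<close>, and the remaining half
is bounded below by the lower frame inequality.
\<close>

lemma norm_relaxation_le:
  assumes "x \<in> V"
  shows "(norm (x - (1 / B) *\<^sub>R S x))\<^sup>2 \<le> (1 - A / B) * (norm x)\<^sup>2"
proof -
  have "(norm (x - (1 / B) *\<^sub>R S x))\<^sup>2
      = (norm x)\<^sup>2 - 2 * (1 / B) * energy x + (1 / B)\<^sup>2 * (norm (S x))\<^sup>2"
    by (rule norm_diff_square) (simp add: ip_S_self[OF assms])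
  also have "\<dots> \<le> (norm x)\<^sup>2 - 2 * (1 / B) * energy x + (1 / B)\<^sup>2 * (B * energy x)"
    by (intro add_left_mono mult_left_mono norm_S_le assms) simp
  also have "\<dots> = (norm x)\<^sup>2 - energy x / B"
    using B_pos by (simp add: field_simps power2_eq_square)
  also have "\<dots> \<le> (norm x)\<^sup>2 - A * (norm x)\<^sup>2 / B"
    using energy_lower[OF assms] B_pos by (simp add: divide_right_mono)
  finally show ?thesis
    by (simp add: algebra_simps)
qed

text \<open>
Solutions of \<open>S x = z\<close> are the fixed points of the relaxation \<open>x - (S x - z) / B\<close>.
\<close>

lemma S_surj:
  assumes z: "z \<in> V"
  shows "z \<in> S ` V"
proof -
  define \<Phi> where "\<Phi> x = x - (1 / B) *\<^sub>R (S x - z)" for x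
  \<comment> \<open>The maximum covers the degenerate case of a trivial span, in which \<open>B < A\<close> is possible.\<close>
  define q where "q = max 0 (1 - A / B)"
  have q: "0 \<le> q" "q < 1"
    using A_pos B_pos by (auto simp: q_def)
  have "\<exists>!x\<in>V. \<Phi> x = x"
  proof (rule Banach_fix)
    show "complete V"
      by (simp add: closed_span_def complete_eq_closed)
    show "V \<noteq> {}"
      using z by blast
    show "0 \<le> sqrt q" "sqrt q < 1"
      using q by auto
    show "\<Phi> ` V \<subseteq> V"
      unfolding \<Phi>_def by (auto intro!: V_diff V_scaleR S_in_V z)
    fix x y assume xy: "x \<in> V" "y \<in> V"
    have "\<Phi> x - \<Phi> y = (x - y) - (1 / B) *\<^sub>R S (x - y)"
      using xy by (simp add: \<Phi>_def S_diff algebra_simps)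
    then have "(norm (\<Phi> x - \<Phi> y))\<^sup>2 \<le> (1 - A / B) * (norm (x - y))\<^sup>2"
      using norm_relaxation_le[OF V_diff[OF xy]] by simp
    also have "\<dots> \<le> q * (norm (x - y))\<^sup>2"
      unfolding q_def by (intro mult_right_mono) auto
    also have "\<dots> = (sqrt q * norm (x - y))\<^sup>2"
      using q by (simp add: power_mult_distrib)
    finally show "dist (\<Phi> x) (\<Phi> y) \<le> sqrt q * dist x y"
      unfolding dist_norm by (rule power2_le_imp_le) (use q in simp)
  qed
  then obtain x where "x \<in> V" "\<Phi> x = x"
    by blast
  then have "x \<in> V" "S x = z"
    using B_pos by (auto simp: \<Phi>_def)
  then show ?thesis
    by blast
qed

abbreviation dual :: "'i \<Rightarrow> 'h" where "dual \<equiv> canonical_dual smul ip f I"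

lemma dual_in_V: "i \<in> I \<Longrightarrow> dual i \<in> V" and S_dual: "i \<in> I \<Longrightarrow> S (dual i) = f i"
  unfolding canonical_dual_def
  using S_surj[OF f_in_V] by (auto intro: inv_into_into f_inv_into_f)

lemma ip_dual_self:
  assumes "i \<in> I"
  shows "ip (f i) (dual i) = of_real (energy (dual i))"
  using ip_S_self[OF dual_in_V[OF assms]] by (simp add: S_dual[OF assms])

lemma norm_ip_dual_self:
  assumes "i \<in> I"
  shows "norm (ip (f i) (dual i)) = repart (ip (f i) (dual i))"
  using energy_nonneg by (simp add: ip_dual_self[OF assms])

lemma energy_diff:
  assumes "x \<in> V" "y \<in> V" and m: "ip (S y) x = of_real m"
  shows "energy (x - t *\<^sub>R y) = energy x - 2 * t * m + t\<^sup>2 * energy y"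
proof -
  have m': "ip (S x) y = of_real m"
    using m S_adjoint[OF assms(1,2)] ip_commute[of x "S y"] by simp
  have "(of_real (energy (x - t *\<^sub>R y)) :: 'k)
      = of_real (energy x - 2 * t * m + t\<^sup>2 * energy y)"
    using assms(1,2)
    by (simp add: V_diff V_scaleR S_diff S_scaleR ip_diff_left ip_diff_right
        ip_scaleR_left ip_scaleR_right m m' algebra_simps power2_eq_square ip_S_self
        flip: ip_S_self[OF V_diff[OF assms(1) V_scaleR[OF assms(2)]]])
  then show ?thesis
    by (simp only: of_real_eq_iff)
qed

text \<open>
Vectors \<open>x\<close> with most of their energy in \<open>F\<close> are excluded by comparing \<open>x\<close> with the part \<open>y\<close>
of its dual expansion over \<open>F\<close>: the energy form pairs \<open>x\<close> and \<open>y\<close> to \<open>m\<close>, and \<open>y\<close> itself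
has energy at most \<open>\<beta> m\<close> by the bound on the Gram matrix.
\<close>

lemma energy_on_subset_le:
  assumes x: "x \<in> V" and F: "finite F" "F \<subseteq> I" and \<beta>: "0 < \<beta>"
    and gram: "\<And>c. norm (\<Sum>i\<in>F. \<Sum>j\<in>F. c i * cnjg (c j) * ip (f i) (dual j))
      \<le> \<beta> * (\<Sum>i\<in>F. (norm (c i))\<^sup>2)"
  shows "(\<Sum>i\<in>F. (norm (ip x (f i)))\<^sup>2) \<le> \<beta> * energy x"
proof -
  define c where "c i = ip x (f i)" for i
  define m where "m = (\<Sum>i\<in>F. (norm (c i))\<^sup>2)"
  define y where "y = (\<Sum>i\<in>F. smul (c i) (dual i))"
  have y: "y \<in> V"
    unfolding y_def using F by (intro V_sum closed_span_scale dual_in_V) auto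
  have Sy: "S y = (\<Sum>i\<in>F. smul (c i) (f i))"
    unfolding y_def using F
    by (subst S_sum) (auto intro!: sum.cong closed_span_scale dual_in_V simp: S_scale S_dual dual_in_V subset_iff)
  have Syx: "ip (S y) x = of_real m"
    unfolding Sy m_def c_def by (simp add: ip_sum_left ip_scale_left ip_mult_swap)
  have "(of_real (energy y) :: 'k) = (\<Sum>i\<in>F. \<Sum>j\<in>F. c i * cnjg (c j) * ip (f i) (dual j))"
    unfolding ip_S_self[OF y, symmetric] Sy
    by (subst sum.swap)
      (simp add: y_def ip_sum_left ip_sum_right ip_scale_left ip_scale_right sum_distrib_left mult_ac)
  then have "norm (of_real (energy y) :: 'k) \<le> \<beta> * m"
    using gram[of c] by (simp add: m_def)
  then have ey: "energy y \<le> \<beta> * m"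
    by simp
  \<comment> \<open>The factor \<open>1 / \<beta>\<close> minimises \<open>- 2 t m + t\<^sup>2 \<beta> m\<close>.\<close>
  have "0 \<le> energy (x - (1 / \<beta>) *\<^sub>R y)"
    by (rule energy_nonneg)
  also have "\<dots> = energy x - 2 * (1 / \<beta>) * m + (1 / \<beta>)\<^sup>2 * energy y"
    by (rule energy_diff[OF x y Syx])
  also have "\<dots> \<le> energy x - 2 * (1 / \<beta>) * m + (1 / \<beta>)\<^sup>2 * (\<beta> * m)"
    by (intro add_left_mono mult_left_mono ey) simp
  also have "\<dots> = energy x - m / \<beta>"
    using \<beta> by (simp add: field_simps power2_eq_square)
  finally show ?thesis
    using \<beta> by (simp add: m_def c_def field_simps)
qed

text \<open>
The lower bound survives the removal of \<open>J\<close> because the finite subsets of \<open>J\<close>, hence \<open>J\<close> itself,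
carry at most the fraction \<open>\<beta>\<close> of the energy.
\<close>

lemma frame_bounds_remove:
  assumes J: "J \<subseteq> I" and \<beta>: "0 < \<beta>" "\<beta> < 1"
    and gram: "\<And>F c. finite F \<Longrightarrow> F \<subseteq> J \<Longrightarrow>
      norm (\<Sum>i\<in>F. \<Sum>j\<in>F. c i * cnjg (c j) * ip (f i) (dual j)) \<le> \<beta> * (\<Sum>i\<in>F. (norm (c i))\<^sup>2)"
  shows "frame_bounds ip f (I - J) V (A * (1 - \<beta>)) B"
proof -
  have "(\<lambda>i. (norm (ip x (f i)))\<^sup>2) summable_on I - J \<and>
        A * (1 - \<beta>) * (norm x)\<^sup>2 \<le> (\<Sum>\<^sub>\<infinity>i\<in>I - J. (norm (ip x (f i)))\<^sup>2) \<and>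
        (\<Sum>\<^sub>\<infinity>i\<in>I - J. (norm (ip x (f i)))\<^sup>2) \<le> B * (norm x)\<^sup>2" if x: "x \<in> V" for x
  proof -
    let ?g = "\<lambda>i. (norm (ip x (f i)))\<^sup>2"
    have sI: "?g summable_on I"
      by (rule energy_summable[OF x])
    then have s: "?g summable_on J" "?g summable_on I - J"
      using J by (auto intro: summable_on_subset_banach)
    have "infsum ?g J \<le> \<beta> * energy x"
      by (rule infsum_le_finite_sums[OF s(1)])
        (use J in \<open>auto intro!: energy_on_subset_le[OF x _ _ \<beta>(1)] gram\<close>)
    moreover have "energy x = infsum ?g J + infsum ?g (I - J)"
      unfolding energy_def using infsum_Un_disjoint[OF s] J
      by (metis Diff_disjoint Diff_partition)
    moreover have "A * (norm x)\<^sup>2 * (1 - \<beta>) \<le> energy x * (1 - \<beta>)"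
      using \<beta> by (intro mult_right_mono energy_lower x) auto
    moreover have "0 \<le> infsum ?g J"
      by (rule infsum_nonneg) simp
    ultimately show ?thesis
      using s energy_upper[OF x] by (simp add: algebra_simps)
  qed
  moreover have "f ` (I - J) \<subseteq> V"
    using f_in_V by blast
  ultimately show ?thesis
    using A_pos B_pos \<beta> by (simp add: frame_bounds_def)
qed

end

section \<open>Schur's test\<close>

text \<open>
The off-diagonal products are split by \<open>|c\<^sub>i| |c\<^sub>j| \<le> |c\<^sub>i|\<^sup>2 / 2 + |c\<^sub>j|\<^sup>2 / 2\<close>; one half is summed along
the rows and the other along the columns. For a matrix with the same bound \<open>\<epsilon>\<close> on both, the factor is
again \<open>\<epsilon>\<close>.
\<close>

lemma schur_test:
  fixes c :: "'i \<Rightarrow> 'k::real_or_complex" and M :: "'i \<Rightarrow> 'i \<Rightarrow> 'k"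
  assumes F: "finite F"
    and diag: "\<And>i. i \<in> F \<Longrightarrow> norm (M i i) \<le> \<alpha>"
    and row: "\<And>i. i \<in> F \<Longrightarrow> (\<Sum>j\<in>F - {i}. norm (M i j)) \<le> \<epsilon>"
    and col: "\<And>j. j \<in> F \<Longrightarrow> (\<Sum>i\<in>F - {j}. norm (M i j)) \<le> \<epsilon>"
  shows "norm (\<Sum>i\<in>F. \<Sum>j\<in>F. c i * cnjg (c j) * M i j) \<le> (\<alpha> + \<epsilon>) * (\<Sum>i\<in>F. (norm (c i))\<^sup>2)"
proof -
  define w where "w i = (norm (c i))\<^sup>2" for i
  define m where "m i j = (if i = j then 0 else norm (M i j))" for i j
  have m_nonneg: "0 \<le> m i j" for i j
    by (simp add: m_def)
  have m_row: "(\<Sum>j\<in>F. m i j) \<le> \<epsilon>" if "i \<in> F" for i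
  proof -
    have "(\<Sum>j\<in>F. m i j) = (\<Sum>j\<in>F - {i}. m i j)"
      using F by (intro sum.mono_neutral_right) (auto simp: m_def)
    also have "\<dots> = (\<Sum>j\<in>F - {i}. norm (M i j))"
      by (intro sum.cong) (auto simp: m_def)
    finally show ?thesis using row[OF that] by simp
  qed
  have m_col: "(\<Sum>i\<in>F. m i j) \<le> \<epsilon>" if "j \<in> F" for j
  proof -
    have "(\<Sum>i\<in>F. m i j) = (\<Sum>i\<in>F - {j}. m i j)"
      using F by (intro sum.mono_neutral_right) (auto simp: m_def)
    also have "\<dots> = (\<Sum>i\<in>F - {j}. norm (M i j))"
      by (intro sum.cong) (auto simp: m_def)
    finally show ?thesis using col[OF that] by simp
  qed
  have pointwise: "norm (c i * cnjg (c j) * M i j)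
      \<le> (if j = i then \<alpha> * w i else 0) + (w i / 2 * m i j + w j / 2 * m i j)"
    if "i \<in> F" "j \<in> F" for i j
  proof (cases "i = j")
    case True
    then show ?thesis
      using mult_left_mono[OF diag[OF that(1)], of "w i"]
      by (simp add: m_def w_def norm_mult power2_eq_square mult_ac)
  next
    case False
    have "norm (c i) * norm (c j) \<le> w i / 2 + w j / 2"
      using sum_squares_bound[of "norm (c i)" "norm (c j)"] by (simp add: w_def)
    then have "norm (c i) * norm (c j) * m i j \<le> (w i / 2 + w j / 2) * m i j"
      by (rule mult_right_mono) (rule m_nonneg)
    with False show ?thesis
      by (simp add: m_def norm_mult algebra_simps)
  qed
  have "norm (\<Sum>i\<in>F. \<Sum>j\<in>F. c i * cnjg (c j) * M i j)
      \<le> (\<Sum>i\<in>F. \<Sum>j\<in>F. norm (c i * cnjg (c j) * M i j))"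
    by (rule order_trans[OF norm_sum]) (intro sum_mono norm_sum)
  also have "\<dots> \<le> (\<Sum>i\<in>F. \<Sum>j\<in>F. (if j = i then \<alpha> * w i else 0)
      + (w i / 2 * m i j + w j / 2 * m i j))"
    by (intro sum_mono pointwise)
  also have "\<dots> = (\<Sum>i\<in>F. \<alpha> * w i) + ((\<Sum>i\<in>F. w i / 2 * (\<Sum>j\<in>F. m i j))
      + (\<Sum>j\<in>F. w j / 2 * (\<Sum>i\<in>F. m i j)))"
    unfolding sum_distrib_left sum.distrib sum.swap[of "\<lambda>i j. w j / 2 * m i j"]
    using F by simp
  also have "\<dots> \<le> (\<Sum>i\<in>F. \<alpha> * w i) + ((\<Sum>i\<in>F. w i / 2 * \<epsilon>) + (\<Sum>j\<in>F. w j / 2 * \<epsilon>))"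
    by (intro add_left_mono add_mono sum_mono mult_left_mono m_row m_col)
      (simp_all add: w_def)
  also have "\<dots> = (\<alpha> + \<epsilon>) * (\<Sum>i\<in>F. w i)"
    by (simp add: sum_distrib_left algebra_simps flip: sum.distrib)
  finally show ?thesis
    by (simp add: w_def)
qed

section \<open>Groups with a length: tilings and densities\<close>

locale length_group = group G for G (structure) +
  fixes len :: "'a \<Rightarrow> real"
  assumes len_one: "len \<one> = 0"
    and len_inv: "x \<in> carrier G \<Longrightarrow> len (inv x) = len x"
    and len_mult: "x \<in> carrier G \<Longrightarrow> y \<in> carrier G \<Longrightarrow> len (x \<otimes> y) \<le> len x + len y"
    and finite_ball: "finite {x \<in> carrier G. len x \<le> t}"
begin

definition gdist :: "'a \<Rightarrow> 'a \<Rightarrow> real" where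
  "gdist x y = len (x \<otimes> inv y)"

lemma gdist_self: "x \<in> carrier G \<Longrightarrow> gdist x x = 0"
  by (simp add: gdist_def len_one)

lemma gdist_commute: "x \<in> carrier G \<Longrightarrow> y \<in> carrier G \<Longrightarrow> gdist x y = gdist y x"
  unfolding gdist_def by (subst len_inv[symmetric]) (simp_all add: inv_mult_group)

lemma gdist_triangle:
  assumes "x \<in> carrier G" "y \<in> carrier G" "z \<in> carrier G"
  shows "gdist x z \<le> gdist x y + gdist y z"
proof -
  have "x \<otimes> inv z = (x \<otimes> inv y) \<otimes> (y \<otimes> inv z)"
    using assms by (simp add: m_assoc m_assoc[of "inv y" y "inv z", symmetric])
  then show ?thesis
    using len_mult[of "x \<otimes> inv y" "y \<otimes> inv z"] assms by (simp add: gdist_def)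
qed

lemma mem_window: "k \<in> window G len N j \<longleftrightarrow> k \<in> carrier G \<and> gdist k j \<le> real N / 2"
  by (simp add: window_def gdist_def)

lemma self_mem_window: "j \<in> carrier G \<Longrightarrow> j \<in> window G len N j"
  by (simp add: mem_window gdist_self)

lemma bij_betw_window:
  assumes "j \<in> carrier G"
  shows "bij_betw (\<lambda>k. k \<otimes> inv j) (window G len N j) {x \<in> carrier G. len x \<le> real N / 2}"
  by (rule bij_betwI[where g = "\<lambda>k. k \<otimes> j"])
    (use assms in \<open>auto simp: window_def m_assoc\<close>)

lemma finite_window: "j \<in> carrier G \<Longrightarrow> finite (window G len N j)"
  using bij_betw_finite[OF bij_betw_window] finite_ball by blast

text \<open>
By right translation all windows of the same size look alike; the windows at \<open>\<one>\<close> are the balls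
around the neutral element.
\<close>

lemma card_window:
  "j \<in> carrier G \<Longrightarrow> card (window G len N j) = card (window G len N \<one>)"
  using bij_betw_same_card[OF bij_betw_window, of j] bij_betw_same_card[OF bij_betw_window, of \<one>]
  by simp

lemma card_window_pos: "j \<in> carrier G \<Longrightarrow> 0 < card (window G len N j)"
  using finite_window[of j N] self_mem_window[of j N] by (auto simp: card_gt_0_iff)

end

text \<open>
The map \<open>p\<close> in the second axiom sends a point to the marked point of its tile. The tiles are uniformly
bounded, all of them have \<open>q\<close> elements, and distinct marked points are at distance more than \<open>R\<close>. The
first axiom says that the boundary of a large window is negligible, so that counting tiles that meet
the window and counting tiles inside it gives the same result in the limit.
\<close>

locale tiled_length_group = length_group +
  assumes growth: "(\<lambda>N. real (card (window G len (N + C) \<one>)) / real (card (window G len N \<one>)))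
      \<longlonglongrightarrow> 1"
    and tiling: "\<exists>p D q. p \<in> carrier G \<rightarrow> carrier G \<and> 0 < q \<and>
      (\<forall>k\<in>carrier G. len (k \<otimes> inv (p k)) \<le> D \<and> card {x \<in> carrier G. p x = p k} = q) \<and>
      (\<forall>k\<in>carrier G. \<forall>l\<in>carrier G. p k \<noteq> p l \<longrightarrow> R < len (p k \<otimes> inv (p l)))"
begin

text \<open>
Each tile \<open>l\<close> is represented by the point \<open>a (sel l)\<close>, and every element of the tile is within \<open>E + D\<close>
of it. Consequently the union \<open>U\<close> of the tiles represented in the window of size \<open>N\<close> lies in the window
of size \<open>N + C\<close>, and for size \<open>N + C\<close> the union covers the window of size \<open>N\<close>. The condition on \<open>C\<close>
involves \<open>C / 2\<close> because a window of size \<open>N\<close> has radius \<open>N / 2\<close>.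
\<close>

lemma card_tiled_window:
  fixes C :: nat
  assumes p: "p \<in> carrier G \<rightarrow> carrier G"
    and p_dist: "\<And>k. k \<in> carrier G \<Longrightarrow> gdist k (p k) \<le> D"
    and p_card: "\<And>k. k \<in> carrier G \<Longrightarrow> card {x \<in> carrier G. p x = p k} = q"
    and q: "0 < q"
    and sel_inj: "inj_on sel (p ` carrier G)"
    and sel: "\<And>l. l \<in> p ` carrier G \<Longrightarrow> a (sel l) \<in> carrier G \<and> gdist (a (sel l)) l \<le> E"
    and C: "E + D \<le> real C / 2"
    and j: "j \<in> carrier G"
  defines "W \<equiv> \<lambda>N. index_window G len (sel ` p ` carrier G) a N j"
  shows "finite (W N)"
    and "q * card (W N) \<le> card (window G len (N + C) j)"
    and "card (window G len N j) \<le> q * card (W (N + C))"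
proof -
  define T where "T N = {l \<in> p ` carrier G. sel l \<in> W N}" for N
  define U where "U N = {k \<in> carrier G. p k \<in> T N}" for N
  have T_iff: "l \<in> T N \<longleftrightarrow> l \<in> p ` carrier G \<and> gdist (a (sel l)) j \<le> real N / 2" for l N
    using sel by (auto simp: T_def W_def index_window_def mem_window)
  have near: "gdist k (a (sel (p k))) \<le> E + D" if "k \<in> carrier G" for k
    using funcset_mem[OF p that] gdist_triangle[of k "p k" "a (sel (p k))"] p_dist[OF that] sel[of "p k"] that p
      gdist_commute[of "p k" "a (sel (p k))"]
    by auto
  have U_sub: "U N \<subseteq> window G len (N + C) j" for N
  proof
    fix k assume "k \<in> U N"
    then have k: "k \<in> carrier G" "gdist (a (sel (p k))) j \<le> real N / 2"
      by (auto simp: U_def T_iff)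
    then show "k \<in> window G len (N + C) j"
      using gdist_triangle[of k "a (sel (p k))" j] near[of k] sel[of "p k"] j C
      by (auto simp: mem_window)
  qed
  have U_sup: "window G len N j \<subseteq> U (N + C)" for N
  proof
    fix k assume "k \<in> window G len N j"
    then have k: "k \<in> carrier G" "gdist k j \<le> real N / 2"
      by (auto simp: mem_window)
    then show "k \<in> U (N + C)"
      using gdist_triangle[of "a (sel (p k))" k j] near[of k] sel[of "p k"] j C
        gdist_commute[of k "a (sel (p k))"]
      by (auto simp: U_def T_iff)
  qed
  have finU: "finite (U N)" for N
    using U_sub finite_window[OF j] finite_subset by blast
  have T_eq: "T N = p ` U N" for N
    by (auto simp: U_def T_iff)
  have finT: "finite (T N)" for N
    unfolding T_eq using finU by blast
  have W_eq: "W N = sel ` T N" for N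
    by (auto simp: T_def W_def index_window_def)
  have cardW: "card (W N) = card (T N)" for N
    unfolding W_eq by (rule card_image) (rule inj_on_subset[OF sel_inj], auto simp: T_def)
  have cardU: "card (U N) = q * card (T N)" for N
  proof -
    have "U N = (\<Union>l\<in>T N. {x \<in> carrier G. p x = l})"
      by (auto simp: U_def)
    moreover have "finite {x \<in> carrier G. p x = l} \<and> card {x \<in> carrier G. p x = l} = q"
      if "l \<in> T N" for l
      using that p_card q by (auto simp: T_iff intro: card_ge_0_finite)
    ultimately have "card (U N) = (\<Sum>l\<in>T N. q)"
      using finT by (simp only:) (subst card_UN_disjoint, auto)
    then show ?thesis by simp
  qed
  show "finite (W N)"
    unfolding W_eq using finT by blast
  show "q * card (W N) \<le> card (window G len (N + C) j)"
    unfolding cardW cardU[symmetric] by (intro card_mono finite_window j U_sub)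
  show "card (window G len N j) \<le> q * card (W (N + C))"
    unfolding cardW cardU[symmetric] by (intro card_mono finU U_sup)
qed

lemma density_eq_if_ratios_between:
  assumes lo: "lo \<longlonglongrightarrow> \<delta>" and hi: "hi \<longlonglongrightarrow> \<delta>"
    and between: "\<And>N j. N \<ge> C \<Longrightarrow> j \<in> carrier G \<Longrightarrow>
      ennreal (lo N) \<le> density_ratio G len J a N j \<and> density_ratio G len J a N j \<le> ennreal (hi N)"
  shows "lower_density G len J a = ennreal \<delta>" "upper_density G len J a = ennreal \<delta>"
proof -
  let ?r = "density_ratio G len J a"
  have lo': "(\<lambda>N. ennreal (lo N)) \<longlonglongrightarrow> ennreal \<delta>" and hi': "(\<lambda>N. ennreal (hi N)) \<longlonglongrightarrow> ennreal \<delta>"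
    using lo hi by (auto intro: tendsto_ennrealI)
  have 1: "ennreal (lo N) \<le> (INF j\<in>carrier G. ?r N j)" if "N \<ge> C" for N
    using between[OF that] by (intro INF_greatest) auto
  have 2: "(INF j\<in>carrier G. ?r N j) \<le> ?r N \<one>" "?r N \<one> \<le> (SUP j\<in>carrier G. ?r N j)" for N
    by (auto intro: INF_lower SUP_upper)
  have 3: "(SUP j\<in>carrier G. ?r N j) \<le> ennreal (hi N)" if "N \<ge> C" for N
    using between[OF that] by (intro SUP_least) auto
  have le: "(INF j\<in>carrier G. ?r N j) \<le> (SUP j\<in>carrier G. ?r N j)" for N
    using 2 order_trans by blast
  have "(\<lambda>N. INF j\<in>carrier G. ?r N j) \<longlonglongrightarrow> ennreal \<delta>"
    by (rule tendsto_sandwich[OF _ _ lo' hi'])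
      (use 1 3 le order_trans in \<open>auto simp: eventually_sequentially intro!: exI[of _ C], blast\<close>)
  then show "lower_density G len J a = ennreal \<delta>"
    unfolding lower_density_def by (intro lim_imp_Liminf) simp_all
  have "(\<lambda>N. SUP j\<in>carrier G. ?r N j) \<longlonglongrightarrow> ennreal \<delta>"
    by (rule tendsto_sandwich[OF _ _ lo' hi'])
      (use 1 3 le order_trans in \<open>auto simp: eventually_sequentially intro!: exI[of _ C], blast\<close>)
  then show "upper_density G len J a = ennreal \<delta>"
    unfolding upper_density_def by (intro lim_imp_Limsup) simp_all
qed

text \<open>
By the preceding counts the ratio for size \<open>N\<close> lies, for all centres at once, between
\<open>v (N - C) / (q v N)\<close> and \<open>v (N + C) / (q v N)\<close>, where \<open>v\<close> is the cardinality of a window. Both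
bounds tend to \<open>1 / q\<close>.
\<close>

lemma density_tiled:
  assumes p: "p \<in> carrier G \<rightarrow> carrier G"
    and p_dist: "\<And>k. k \<in> carrier G \<Longrightarrow> gdist k (p k) \<le> D"
    and p_card: "\<And>k. k \<in> carrier G \<Longrightarrow> card {x \<in> carrier G. p x = p k} = q"
    and q: "0 < q"
    and sel_inj: "inj_on sel (p ` carrier G)"
    and sel: "\<And>l. l \<in> p ` carrier G \<Longrightarrow> a (sel l) \<in> carrier G \<and> gdist (a (sel l)) l \<le> E"
  defines "J \<equiv> sel ` p ` carrier G"
  shows "lower_density G len J a = ennreal (1 / real q)" "upper_density G len J a = ennreal (1 / real q)"
proof -
  obtain C :: nat where "2 * (E + D) \<le> real C"
    using real_arch_simple by blast
  then have C: "E + D \<le> real C / 2"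
    by simp
  define v where "v N = real (card (window G len N \<one>))" for N
  have v_pos: "0 < v N" for N
    using card_window_pos[OF one_closed] by (simp add: v_def)
  define lo where "lo N = v (N - C) / v N / q" for N
  define hi where "hi N = v (N + C) / v N / q" for N
  have grow: "(\<lambda>N. v (N + C) / v N) \<longlonglongrightarrow> 1"
    using growth[of C] by (simp add: v_def)
  have hi_lim: "hi \<longlonglongrightarrow> 1 / real q"
    unfolding hi_def by (intro tendsto_divide grow) (use q in simp_all)
  have "(\<lambda>N. inverse (v (N + C) / v N)) \<longlonglongrightarrow> inverse 1"
    by (rule tendsto_inverse[OF grow]) simp
  then have "(\<lambda>N. v (N + C - C) / v (N + C)) \<longlonglongrightarrow> 1"
    by simp
  then have "(\<lambda>N. v (N - C) / v N) \<longlonglongrightarrow> 1"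
    by (rule LIMSEQ_offset)
  then have lo_lim: "lo \<longlonglongrightarrow> 1 / real q"
    unfolding lo_def by (intro tendsto_divide) (use q in simp_all)
  have "ennreal (lo N) \<le> density_ratio G len J a N j \<and> density_ratio G len J a N j \<le> ennreal (hi N)"
    if N: "N \<ge> C" and j: "j \<in> carrier G" for N j
  proof -
    let ?W = "index_window G len J a N j"
    note tiled = card_tiled_window[OF p p_dist p_card q sel_inj sel C j, folded J_def]
    have fin: "finite ?W"
      by (rule tiled(1))
    have "real q * real (card ?W) \<le> v (N + C)"
      using tiled(2)[of N] card_window[OF j] by (simp add: v_def flip: of_nat_mult)
    moreover have "v (N - C) \<le> real q * real (card ?W)"
      using tiled(3)[of "N - C"] N card_window[OF j] by (simp add: v_def flip: of_nat_mult)
    moreover have "density_ratio G len J a N j = ennreal (real (card ?W) / v N)"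
      using fin v_pos[of N] card_window[OF j, of N]
      by (simp add: density_ratio_def v_def ennreal_of_nat_eq_real_of_nat divide_ennreal)
    ultimately show ?thesis
      using q v_pos[of N] unfolding lo_def hi_def
      by (auto intro!: ennreal_leI simp: field_simps)
  qed
  note between = this
  show "lower_density G len J a = ennreal (1 / real q)"
    by (rule density_eq_if_ratios_between(1)[OF lo_lim hi_lim between])
  show "upper_density G len J a = ennreal (1 / real q)"
    by (rule density_eq_if_ratios_between(2)[OF lo_lim hi_lim between])
qed

text \<open>
Choosing one point of \<open>K\<close> near each marked point moves the marked points by at most \<open>N / 2\<close> each, so
a tiling that is separated by \<open>R + N\<close> leaves a separation by \<open>R\<close>.
\<close>

lemma separated_subset_with_density:
  assumes hit: "\<And>j. j \<in> carrier G \<Longrightarrow> \<exists>i\<in>K. a i \<in> window G len N j" and R: "0 \<le> R"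
  obtains J where "J \<subseteq> K" "upper_density G len J a = lower_density G len J a"
    "0 < lower_density G len J a"
    "\<And>i j. i \<in> J \<Longrightarrow> j \<in> J \<Longrightarrow> i \<noteq> j \<Longrightarrow> R < len (a i \<otimes> inv (a j))"
proof -
  obtain p D q where pDq: "p \<in> carrier G \<rightarrow> carrier G \<and> 0 < q \<and>
      (\<forall>k\<in>carrier G. gdist k (p k) \<le> D \<and> card {x \<in> carrier G. p x = p k} = q) \<and>
      (\<forall>k\<in>carrier G. \<forall>l\<in>carrier G. p k \<noteq> p l \<longrightarrow> R + real N < gdist (p k) (p l))"
    using tiling[of "R + real N"] unfolding gdist_def by (elim exE)
  then have p: "p \<in> carrier G \<rightarrow> carrier G" and q: "0 < q"
    and p_dist: "\<And>k. k \<in> carrier G \<Longrightarrow> gdist k (p k) \<le> D"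
    and p_card: "\<And>k. k \<in> carrier G \<Longrightarrow> card {x \<in> carrier G. p x = p k} = q"
    and p_sep: "\<And>k l. k \<in> carrier G \<Longrightarrow> l \<in> carrier G \<Longrightarrow> p k \<noteq> p l \<Longrightarrow> R + real N < gdist (p k) (p l)"
    by simp_all
  define sel where "sel l = (SOME i. i \<in> K \<and> a i \<in> window G len N l)" for l
  have sel: "sel l \<in> K" "a (sel l) \<in> carrier G" "gdist (a (sel l)) l \<le> real N / 2"
    if "l \<in> p ` carrier G" for l
  proof -
    have "l \<in> carrier G"
      using that p by auto
    then have "\<exists>i. i \<in> K \<and> a i \<in> window G len N l"
      using hit[of l] by blast
    then have "sel l \<in> K \<and> a (sel l) \<in> window G len N l"
      unfolding sel_def by (rule someI_ex)
    then show "sel l \<in> K" "a (sel l) \<in> carrier G" "gdist (a (sel l)) l \<le> real N / 2"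
      by (auto simp: mem_window)
  qed
  have sep: "R < gdist (a (sel l)) (a (sel m))"
    if "l \<in> p ` carrier G" "m \<in> p ` carrier G" "l \<noteq> m" for l m
  proof -
    have lm: "l \<in> carrier G" "m \<in> carrier G"
      using that p by auto
    have "R + real N < gdist l m"
      using p_sep that by auto
    also have "\<dots> \<le> gdist l (a (sel l)) + (gdist (a (sel l)) (a (sel m)) + gdist (a (sel m)) m)"
      using gdist_triangle[of l "a (sel l)" m] gdist_triangle[of "a (sel l)" "a (sel m)" m]
        sel that lm by fastforce
    finally show ?thesis
      using sel[OF that(1)] sel[OF that(2)] gdist_commute[of l "a (sel l)"] lm by simp
  qed
  have inj: "inj_on sel (p ` carrier G)"
  proof (rule inj_onI, rule ccontr)
    fix l m assume lm: "l \<in> p ` carrier G" "m \<in> p ` carrier G" "sel l = sel m" "l \<noteq> m"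
    then show False
      using sep[OF lm(1,2,4)] R sel(2)[OF lm(2)] by (simp add: gdist_self)
  qed
  let ?J = "sel ` p ` carrier G"
  have dens: "lower_density G len ?J a = ennreal (1 / real q)"
    "upper_density G len ?J a = ennreal (1 / real q)"
    by (rule density_tiled[OF p p_dist p_card q inj, where E = "real N / 2"]; use sel in blast)+
  show thesis
  proof (rule that[of ?J])
    show "?J \<subseteq> K"
      using sel by blast
    show "R < len (a i \<otimes> inv (a j))" if "i \<in> ?J" "j \<in> ?J" "i \<noteq> j" for i j
    proof -
      from that obtain l m where lm: "l \<in> p ` carrier G" "m \<in> p ` carrier G" "i = sel l" "j = sel m"
        by blast
      with \<open>i \<noteq> j\<close> have "l \<noteq> m"
        by blast
      with sep[OF lm(1,2)] show ?thesis
        by (simp add: lm gdist_def)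
    qed
  qed (use dens q in simp_all)
qed

end

context length_group
begin

text \<open>
For a fixed \<open>i\<close> the differences \<open>a i - a j\<close> with \<open>j\<close> in a separated set are distinct and of length
more than \<open>R\<close>. The sum of \<open>r\<close> over them is thus a piece of the tail of a summable series. The order of
the quantifiers matters: \<open>R\<close> is fixed before the set \<open>J\<close> is constructed from it.
\<close>

lemma small_off_diagonal:
  fixes r :: "'a \<Rightarrow> real" and m :: "'i \<Rightarrow> 'i \<Rightarrow> real"
  assumes r: "(\<lambda>g. norm (r g)) summable_on carrier G" and \<epsilon>: "0 < \<epsilon>"
    and a: "a \<in> I \<rightarrow> carrier G"
    and m: "\<And>i j. i \<in> I \<Longrightarrow> j \<in> I \<Longrightarrow> m i j \<le> r (a i \<otimes> inv (a j))"
  obtains R where "0 \<le> R"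
    "\<And>J F i. J \<subseteq> I \<Longrightarrow> (\<And>i j. i \<in> J \<Longrightarrow> j \<in> J \<Longrightarrow> i \<noteq> j \<Longrightarrow> R < len (a i \<otimes> inv (a j))) \<Longrightarrow>
      finite F \<Longrightarrow> F \<subseteq> J \<Longrightarrow> i \<in> F \<Longrightarrow>
      (\<Sum>j\<in>F - {i}. m i j) \<le> \<epsilon> \<and> (\<Sum>j\<in>F - {i}. m j i) \<le> \<epsilon>"
proof -
  obtain E where E: "finite E" "E \<subseteq> carrier G"
    and tail: "\<And>T. finite T \<Longrightarrow> T \<subseteq> carrier G - E \<Longrightarrow> (\<Sum>g\<in>T. norm (r g)) < \<epsilon>"
    using summable_on_small_tail[OF r _ \<epsilon>] by auto
  define R where "R = Max (insert 0 (len ` E))"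
  have R: "0 \<le> R" "\<And>g. g \<in> E \<Longrightarrow> len g \<le> R"
    using E by (auto simp: R_def)
  have "(\<Sum>j\<in>F - {i}. m i j) \<le> \<epsilon> \<and> (\<Sum>j\<in>F - {i}. m j i) \<le> \<epsilon>"
    if J: "J \<subseteq> I" and sep: "\<And>i j. i \<in> J \<Longrightarrow> j \<in> J \<Longrightarrow> i \<noteq> j \<Longrightarrow> R < len (a i \<otimes> inv (a j))"
      and F: "finite F" "F \<subseteq> J" and i: "i \<in> F" for J F i
  proof -
    have inJ: "j \<in> J \<and> j \<in> I \<and> a j \<in> carrier G" if "j \<in> F" for j
      using that F J a by auto
    have inj_a: "j = k" if "j \<in> F" "k \<in> F" "a j = a k" for j k
      using sep[of j k] that inJ[OF that(1)] inJ[OF that(2)] R(1) by (auto simp: len_one)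
    have *: "(\<Sum>j\<in>F - {i}. m' j) \<le> \<epsilon>"
      if inj: "inj_on h (F - {i})" and h: "\<And>j. j \<in> F - {i} \<Longrightarrow> h j \<in> carrier G \<and> R < len (h j)"
        and m': "\<And>j. j \<in> F - {i} \<Longrightarrow> m' j \<le> r (h j)" for h m'
    proof -
      have "(\<Sum>j\<in>F - {i}. m' j) \<le> (\<Sum>j\<in>F - {i}. norm (r (h j)))"
        using m' by (intro sum_mono) fastforce
      also have "\<dots> = (\<Sum>g\<in>h ` (F - {i}). norm (r g))"
        using inj by (simp add: sum.reindex)
      also have "\<dots> < \<epsilon>"
        using F h R(2) by (intro tail) fastforce+
      finally show ?thesis by simp
    qed
    have "(\<Sum>j\<in>F - {i}. m i j) \<le> \<epsilon>"
    proof (rule *)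
      show "inj_on (\<lambda>j. a i \<otimes> inv (a j)) (F - {i})"
      proof (rule inj_onI)
        fix j k assume jk: "j \<in> F - {i}" "k \<in> F - {i}" "a i \<otimes> inv (a j) = a i \<otimes> inv (a k)"
        then have "inv (a j) = inv (a k)"
          using inJ i by (simp add: Units_eq)
        then have "a j = a k"
          using jk inJ by (metis DiffD1 inv_inv)
        with jk show "j = k"
          using inj_a by blast
      qed
    qed (use i inJ m sep in auto)
    moreover have "(\<Sum>j\<in>F - {i}. m j i) \<le> \<epsilon>"
    proof (rule *)
      show "inj_on (\<lambda>j. a j \<otimes> inv (a i)) (F - {i})"
        using inj_a inJ i by (auto intro!: inj_onI)
    qed (use i inJ m sep in auto)
    ultimately show ?thesis by simp
  qed
  with R(1) show thesis using that by blast
qed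

end

section \<open>The index group\<close>

lemma carrier_lattice_group: "carrier (lattice_group s) = range (\<lambda>k::int. s * of_int k)"
  by (simp add: lattice_group_def)

lemma mem_lattice_group: "s * of_int k \<in> carrier (lattice_group s)"
  unfolding carrier_lattice_group by (rule rangeI)

lemma group_lattice_group: "group (lattice_group s)"
proof (rule groupI)
  fix x y assume "x \<in> carrier (lattice_group s)" "y \<in> carrier (lattice_group s)"
  then show "x \<otimes>\<^bsub>lattice_group s\<^esub> y \<in> carrier (lattice_group s)"
    by (auto simp: lattice_group_def simp flip: of_int_add distrib_left of_int_mult)
next
  show "\<one>\<^bsub>lattice_group s\<^esub> \<in> carrier (lattice_group s)"
    by (auto simp: lattice_group_def intro: range_eqI[of _ _ 0])
next
  fix x assume "x \<in> carrier (lattice_group s)"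
  then obtain k where "x = s * of_int k"
    by (auto simp: lattice_group_def)
  then have "s * of_int (- k) \<otimes>\<^bsub>lattice_group s\<^esub> x = \<one>\<^bsub>lattice_group s\<^esub>"
    by (simp add: lattice_group_def)
  with mem_lattice_group show "\<exists>y\<in>carrier (lattice_group s). y \<otimes>\<^bsub>lattice_group s\<^esub> x = \<one>\<^bsub>lattice_group s\<^esub>"
    by blast
qed (simp_all add: lattice_group_def)

lemma inv_lattice_group:
  assumes "x \<in> carrier (lattice_group s)"
  shows "inv\<^bsub>lattice_group s\<^esub> x = - x"
proof (rule group.inv_equality[OF group_lattice_group _ assms])
  obtain k where "x = s * of_int k"
    using assms by (auto simp: lattice_group_def)
  then have "- x = s * of_int (- k)"
    by simp
  then show "- x \<in> carrier (lattice_group s)"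
    by (simp only: mem_lattice_group)
qed (simp add: lattice_group_def)

lemma lattice_ball:
  assumes "0 < s"
  shows "{z \<in> carrier (lattice_group s). \<bar>z\<bar> \<le> t} = (\<lambda>k. s * of_int k) ` {- \<lfloor>t / s\<rfloor>..\<lfloor>t / s\<rfloor>}"
proof -
  have "\<bar>s * of_int k\<bar> \<le> t \<longleftrightarrow> k \<in> {- \<lfloor>t / s\<rfloor>..\<lfloor>t / s\<rfloor>}" for k :: int
  proof -
    have "\<bar>s * of_int k\<bar> \<le> t \<longleftrightarrow> of_int \<bar>k\<bar> \<le> t / s"
      using assms by (simp add: abs_mult field_simps)
    also have "\<dots> \<longleftrightarrow> \<bar>k\<bar> \<le> \<lfloor>t / s\<rfloor>"
      by (simp only: le_floor_iff)
    finally show ?thesis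
      by auto
  qed
  then show ?thesis
    unfolding carrier_lattice_group by blast
qed

lemma inj_lattice: "0 < (s::real) \<Longrightarrow> inj_on (\<lambda>k::int. s * of_int k) X"
  by (rule inj_onI) simp

lemma card_lattice_ball:
  assumes "0 < s" "0 \<le> t"
  shows "real (card {z \<in> carrier (lattice_group s). \<bar>z\<bar> \<le> t}) = 2 * of_int \<lfloor>t / s\<rfloor> + 1"
proof -
  have "0 \<le> \<lfloor>t / s\<rfloor>"
    using assms by simp
  then show ?thesis
    unfolding lattice_ball[OF assms(1)] card_image[OF inj_lattice[OF assms(1)]] by simp
qed

lemma lattice_cell_diameter:
  assumes "0 < (c::real)"
  shows "\<bar>z - c * of_int \<lfloor>z / c\<rfloor>\<bar> \<le> c"
proof -
  have "of_int \<lfloor>z / c\<rfloor> * c \<le> z" "z < (of_int \<lfloor>z / c\<rfloor> + 1) * c"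
    using assms by (rule floor_divide_lower, intro floor_divide_upper)
  then show ?thesis
    unfolding distrib_right by (simp add: mult.commute)
qed

lemma card_lattice_cell:
  assumes "0 < s" "0 < L"
  shows "card {z \<in> carrier (lattice_group s). s * of_int (int L * \<lfloor>z / (s * real L)\<rfloor>) = s * of_int (int L * m)} = L"
proof -
  have "(s * of_int (int L * \<lfloor>s * of_int k / (s * real L)\<rfloor>) = s * of_int (int L * m))
      \<longleftrightarrow> k \<in> {int L * m..<int L * m + int L}" for k :: int
  proof -
    have "\<lfloor>s * of_int k / (s * real L)\<rfloor> = k div int L"
      using assms floor_divide_of_int_eq[of k "int L"] by simp
    moreover have "k div int L = m \<longleftrightarrow> k \<in> {int L * m..<int L * m + int L}"
    proof
      assume m: "k div int L = m"
      then have "k = int L * m + k mod int L"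
        by (metis mult_div_mod_eq)
      then show "k \<in> {int L * m..<int L * m + int L}"
        using assms pos_mod_bound[of "int L" k] pos_mod_sign[of "int L" k]
        unfolding atLeastLessThan_iff by linarith
    next
      assume "k \<in> {int L * m..<int L * m + int L}"
      then show "k div int L = m"
        by (intro int_div_pos_eq[where r = "k - int L * m"]) auto
    qed
    ultimately show ?thesis
      using assms by (simp only: mult_cancel_left of_int_eq_iff) simp
  qed
  then have "{z \<in> carrier (lattice_group s). s * of_int (int L * \<lfloor>z / (s * real L)\<rfloor>) = s * of_int (int L * m)}
      = (\<lambda>k. s * of_int k) ` {int L * m..<int L * m + int L}"
    unfolding carrier_lattice_group by blast
  then show ?thesis
    by (simp add: card_image[OF inj_lattice[OF assms(1)]])
qed

text \<open>
The denominator is at least \<open>N / s - 1\<close>, while numerator and denominator differ by at most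
\<open>C / s + 2\<close>.
\<close>

lemma lattice_ball_growth:
  fixes s :: real
  assumes "0 < s"
  shows "(\<lambda>N. (2 * of_int \<lfloor>real (N + C) / 2 / s\<rfloor> + 1) / (2 * of_int \<lfloor>real N / 2 / s\<rfloor> + 1) :: real) \<longlonglongrightarrow> 1"
proof (rule tendsto_sandwich[where f = "\<lambda>_. 1" and h = "\<lambda>N. 1 + (real C / s + 2) / (real N / s - 1)"])
  show "(\<lambda>N. 1 + (real C / s + 2) / (real N / s - 1)) \<longlonglongrightarrow> 1"
    using assms by real_asymp
  have pos: "0 < 2 * of_int \<lfloor>real N / 2 / s\<rfloor> + (1::real)" for N
    using assms by (simp add: add_nonneg_pos)
  have "of_int \<lfloor>real N / 2 / s\<rfloor> \<le> (of_int \<lfloor>real (N + C) / 2 / s\<rfloor> :: real)" for N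
    using assms by (intro of_int_le_iff[THEN iffD2] floor_mono) (simp add: field_simps)
  then show "\<forall>\<^sub>F N in sequentially. 1 \<le> (2 * of_int \<lfloor>real (N + C) / 2 / s\<rfloor> + 1) / (2 * of_int \<lfloor>real N / 2 / s\<rfloor> + 1 :: real)"
    using pos by (intro always_eventually) (simp add: le_divide_eq)
  have "\<forall>\<^sub>F N in sequentially. s < real N"
    by real_asymp
  then show "\<forall>\<^sub>F N in sequentially. (2 * of_int \<lfloor>real (N + C) / 2 / s\<rfloor> + 1) / (2 * of_int \<lfloor>real N / 2 / s\<rfloor> + 1 :: real)
      \<le> 1 + (real C / s + 2) / (real N / s - 1)"
  proof eventually_elim
    case (elim N)
    define c where "c = 2 * of_int \<lfloor>real N / 2 / s\<rfloor> + (1::real)"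
    define c' where "c' = 2 * of_int \<lfloor>real (N + C) / 2 / s\<rfloor> + (1::real)"
    have c: "real N / s - 1 \<le> c" "0 < c"
      using pos[of N] real_of_int_floor_gt_diff_one[of "real N / 2 / s"]
      unfolding c_def by linarith+
    have "c' \<le> real N / s + real C / s + 1"
    proof -
      have "c' \<le> 2 * (real (N + C) / 2 / s) + 1"
        unfolding c'_def by (intro add_right_mono mult_left_mono of_int_floor_le) simp
      also have "\<dots> = real N / s + real C / s + 1"
        by (simp add: add_divide_distrib)
      finally show ?thesis .
    qed
    then have "c' \<le> c + (real C / s + 2)"
      using c(1) by linarith
    then have "c' / c \<le> 1 + (real C / s + 2) / c"
      using c(2) by (simp add: field_simps)
    also have "\<dots> \<le> 1 + (real C / s + 2) / (real N / s - 1)"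
      using elim assms c by (intro add_left_mono divide_left_mono) auto
    finally show ?case
      by (simp add: c_def c'_def)
  qed
qed simp

lemma index_length_le_iff:
  assumes "1 \<le> d"
  shows "index_length d e g \<le> t \<longleftrightarrow>
    (\<forall>i<d. \<bar>fst g i\<bar> \<le> t) \<and> (\<forall>j<e. snd g j \<noteq> 0 \<longrightarrow> 1 \<le> t)"
proof -
  have "0 < d"
    using assms by simp
  then have "index_length d e g \<le> t \<longleftrightarrow>
    (\<forall>i<d. \<bar>fst g i\<bar> \<le> t) \<and> (\<forall>j<e. (if snd g j = 0 then 0 else 1) \<le> t)"
    unfolding index_length_def by (subst Max_le_iff) auto
  also have "\<dots> \<longleftrightarrow> (\<forall>i<d. \<bar>fst g i\<bar> \<le> t) \<and> (\<forall>j<e. snd g j \<noteq> 0 \<longrightarrow> 1 \<le> t)"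
    using \<open>0 < d\<close> by (smt (verit))
  finally show ?thesis .
qed

locale index_group_data =
  fixes d e :: nat and s :: "nat \<Rightarrow> real" and n :: "nat \<Rightarrow> nat"
  assumes d: "1 \<le> d" and s: "\<And>i. i < d \<Longrightarrow> 0 < s i" and n: "\<And>j. j < e \<Longrightarrow> 1 \<le> n j"
begin

abbreviation "G \<equiv> index_group d s e n"
abbreviation "len \<equiv> index_length d e"

lemmas len_le_iff = index_length_le_iff[OF d, of e]

lemma len_ge: "i < d \<Longrightarrow> \<bar>fst g i\<bar> \<le> len g" "j < e \<Longrightarrow> snd g j \<noteq> 0 \<Longrightarrow> 1 \<le> len g"
proof -
  have "(\<forall>i<d. \<bar>fst g i\<bar> \<le> len g) \<and> (\<forall>j<e. snd g j \<noteq> 0 \<longrightarrow> 1 \<le> len g)"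
    by (rule iffD1[OF len_le_iff order_refl])
  then show "i < d \<Longrightarrow> \<bar>fst g i\<bar> \<le> len g" "j < e \<Longrightarrow> snd g j \<noteq> 0 \<Longrightarrow> 1 \<le> len g"
    by simp_all
qed

lemma group_G: "group G"
  unfolding index_group_def
  by (intro DirProd_group product_group group_lattice_group group_integer_mod_group)

lemma carrier_G: "carrier G = (\<Pi>\<^sub>E i\<in>{..<d}. carrier (lattice_group (s i))) \<times> (\<Pi>\<^sub>E j\<in>{..<e}. {0..<int (n j)})"
proof -
  have "carrier (integer_mod_group (n j)) = {0..<int (n j)}" if "j \<in> {..<e}" for j
    using n[of j] that by (simp add: carrier_integer_mod_group)
  then have "(\<Pi>\<^sub>E j\<in>{..<e}. carrier (integer_mod_group (n j))) = (\<Pi>\<^sub>E j\<in>{..<e}. {0..<int (n j)})"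
    by (rule PiE_cong)
  then show ?thesis
    by (simp only: index_group_def carrier_DirProd carrier_product_group)
qed

lemma fst_mult_G: "i < d \<Longrightarrow> fst (g \<otimes>\<^bsub>G\<^esub> h) i = fst g i + fst h i"
  by (simp add: index_group_def mult_DirProd' lattice_group_def)

lemma snd_mult_G: "j < e \<Longrightarrow> snd (g \<otimes>\<^bsub>G\<^esub> h) j = (snd g j + snd h j) mod int (n j)"
  by (simp add: index_group_def mult_DirProd')

lemma inv_G:
  assumes "g \<in> carrier G"
  shows "i < d \<Longrightarrow> fst (inv\<^bsub>G\<^esub> g) i = - fst g i"
    and "j < e \<Longrightarrow> snd (inv\<^bsub>G\<^esub> g) j = (- snd g j) mod int (n j)"
proof -
  obtain x y where g: "g = (x, y)"
    by force
  have x: "x \<in> carrier (product_group {..<d} (\<lambda>i. lattice_group (s i)))"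
    and y: "y \<in> carrier (product_group {..<e} (\<lambda>j. integer_mod_group (n j)))"
    using assms by (auto simp: g index_group_def)
  have "inv\<^bsub>G\<^esub> g = (inv\<^bsub>product_group {..<d} (\<lambda>i. lattice_group (s i))\<^esub> x,
      inv\<^bsub>product_group {..<e} (\<lambda>j. integer_mod_group (n j))\<^esub> y)"
    unfolding g index_group_def
    by (intro inv_DirProd product_group group_lattice_group group_integer_mod_group x y)
  also have "\<dots> = (\<lambda>i\<in>{..<d}. inv\<^bsub>lattice_group (s i)\<^esub> x i, \<lambda>j\<in>{..<e}. inv\<^bsub>integer_mod_group (n j)\<^esub> y j)"
    using x y by (simp add: group_lattice_group)
  finally have eq: "inv\<^bsub>G\<^esub> g = \<dots>" .
  show "i < d \<Longrightarrow> fst (inv\<^bsub>G\<^esub> g) i = - fst g i"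
    unfolding eq unfolding g using PiE_mem[OF x[unfolded carrier_product_group], of i]
    by (simp add: inv_lattice_group)
  show "j < e \<Longrightarrow> snd (inv\<^bsub>G\<^esub> g) j = (- snd g j) mod int (n j)"
    unfolding eq unfolding g using PiE_mem[OF y[unfolded carrier_product_group], of j]
    by simp
qed

lemma ball_G:
  "{g \<in> carrier G. len g \<le> t} = (\<Pi>\<^sub>E i\<in>{..<d}. {z \<in> carrier (lattice_group (s i)). \<bar>z\<bar> \<le> t})
    \<times> (\<Pi>\<^sub>E j\<in>{..<e}. {y \<in> {0..<int (n j)}. y \<noteq> 0 \<longrightarrow> 1 \<le> t})"
  by (rule Set.set_eqI)
    (simp only: mem_Collect_eq carrier_G len_le_iff mem_Times_iff PiE_iff, blast)

lemma length_group_G: "length_group G len"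
proof -
  interpret group G by (rule group_G)
  show ?thesis
  proof unfold_locales
    have "len \<one>\<^bsub>G\<^esub> \<le> 0"
      by (simp add: len_le_iff index_group_def lattice_group_def)
    moreover have "0 \<le> len \<one>\<^bsub>G\<^esub>"
      using len_ge(1)[of 0 "\<one>\<^bsub>G\<^esub>"] d by simp
    ultimately show "len \<one>\<^bsub>G\<^esub> = 0"
      by simp
    have le: "len (inv\<^bsub>G\<^esub> g) \<le> len g" if "g \<in> carrier G" for g
      unfolding len_le_iff[of "inv\<^bsub>G\<^esub> g"]
      by (auto simp: inv_G[OF that] len_ge(1) intro: len_ge(2))
    show "len (inv\<^bsub>G\<^esub> g) = len g" if "g \<in> carrier G" for g
      using le[OF that] le[of "inv\<^bsub>G\<^esub> g"] that by simp
    have nonneg: "0 \<le> len g" for g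
      using len_ge(1)[of 0 g] d by simp
    show "len (g \<otimes>\<^bsub>G\<^esub> h) \<le> len g + len h" if "g \<in> carrier G" "h \<in> carrier G" for g h
      unfolding len_le_iff[of "g \<otimes>\<^bsub>G\<^esub> h"]
    proof (intro conjI allI impI)
      show "\<bar>fst (g \<otimes>\<^bsub>G\<^esub> h) i\<bar> \<le> len g + len h" if "i < d" for i
        using len_ge(1)[OF that, of g] len_ge(1)[OF that, of h] by (simp add: fst_mult_G that)
      show "1 \<le> len g + len h" if j: "j < e" "snd (g \<otimes>\<^bsub>G\<^esub> h) j \<noteq> 0" for j
      proof -
        have "snd g j \<noteq> 0 \<or> snd h j \<noteq> 0"
          using j by (auto simp: snd_mult_G)
        then show ?thesis
          using len_ge(2)[OF j(1), of g] len_ge(2)[OF j(1), of h] nonneg[of g] nonneg[of h] by auto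
      qed
    qed
    show "finite {g \<in> carrier G. len g \<le> t}" for t
      unfolding ball_G
    proof (intro finite_cartesian_product finite_PiE)
      show "finite {z \<in> carrier (lattice_group (s i)). \<bar>z\<bar> \<le> t}" if "i \<in> {..<d}" for i
        using s that by (simp add: lattice_ball)
      show "finite {y \<in> {0..<int (n j)}. y \<noteq> 0 \<longrightarrow> 1 \<le> t}" for j
        by (rule finite_subset[of _ "{0..<int (n j)}"]) auto
    qed simp_all
  qed
qed

lemma card_ball_G:
  assumes "1 \<le> t"
  shows "real (card {g \<in> carrier G. len g \<le> t}) = (\<Prod>i<d. 2 * of_int \<lfloor>t / s i\<rfloor> + 1) * (\<Prod>j<e. real (n j))"
proof -
  have "{y \<in> {0..<int (n j)}. y \<noteq> 0 \<longrightarrow> 1 \<le> t} = {0..<int (n j)}" for j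
    using assms by blast
  then have "(\<Prod>j<e. real (card {y \<in> {0..<int (n j)}. y \<noteq> 0 \<longrightarrow> 1 \<le> t})) = (\<Prod>j<e. real (n j))"
    by (simp only:) simp
  moreover have "(\<Prod>i<d. real (card {z \<in> carrier (lattice_group (s i)). \<bar>z\<bar> \<le> t}))
      = (\<Prod>i<d. 2 * of_int \<lfloor>t / s i\<rfloor> + 1)"
    using assms s by (intro prod.cong refl card_lattice_ball) auto
  moreover have "real (card {g \<in> carrier G. len g \<le> t})
      = (\<Prod>i<d. real (card {z \<in> carrier (lattice_group (s i)). \<bar>z\<bar> \<le> t})) *
        (\<Prod>j<e. real (card {y \<in> {0..<int (n j)}. y \<noteq> 0 \<longrightarrow> 1 \<le> t}))"
    by (simp only: ball_G card_cartesian_product card_PiE[OF finite_lessThan] of_nat_mult of_nat_prod)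
  ultimately show ?thesis
    by (simp only:)
qed

lemma growth_G:
  "(\<lambda>N. real (card (window G len (N + C) \<one>\<^bsub>G\<^esub>)) / real (card (window G len N \<one>\<^bsub>G\<^esub>))) \<longlonglongrightarrow> 1"
proof (rule Lim_transform_eventually)
  interpret group G by (rule group_G)
  let ?c = "\<lambda>i N. 2 * of_int \<lfloor>real N / 2 / s i\<rfloor> + (1::real)"
  have "(\<lambda>N. \<Prod>i<d. ?c i (N + C) / ?c i N) \<longlonglongrightarrow> (\<Prod>i<d. 1)"
    by (intro tendsto_prod lattice_ball_growth s) simp
  then show "(\<lambda>N. \<Prod>i<d. ?c i (N + C) / ?c i N) \<longlonglongrightarrow> 1"
    by simp
  have window: "window G len N \<one>\<^bsub>G\<^esub> = {g \<in> carrier G. len g \<le> real N / 2}" for N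
    by (auto simp: window_def)
  have n_pos: "(\<Prod>j<e. real (n j)) \<noteq> 0"
    using n by fastforce
  show "\<forall>\<^sub>F N in sequentially. (\<Prod>i<d. ?c i (N + C) / ?c i N)
      = real (card (window G len (N + C) \<one>\<^bsub>G\<^esub>)) / real (card (window G len N \<one>\<^bsub>G\<^esub>))"
    using eventually_ge_at_top[of 2]
  proof eventually_elim
    case (elim N)
    then have "1 \<le> real N / 2" "1 \<le> real (N + C) / 2"
      by simp_all
    then show ?case
      unfolding window using n_pos by (simp only: card_ball_G prod_dividef) simp
  qed
qed

text \<open>
The tiles are boxes with \<open>L\<close> lattice points in each of the \<open>d\<close> free directions and with the whole finite
factor. Different corners then differ in a free coordinate, by at least \<open>s i * L\<close>; so \<open>L\<close> is chosen with
\<open>R < s i * L\<close> for all \<open>i\<close>.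
\<close>

lemma tiling_G:
  "\<exists>p D q. p \<in> carrier G \<rightarrow> carrier G \<and> 0 < q \<and>
    (\<forall>k\<in>carrier G. len (k \<otimes>\<^bsub>G\<^esub> inv\<^bsub>G\<^esub> (p k)) \<le> D \<and> card {x \<in> carrier G. p x = p k} = q) \<and>
    (\<forall>k\<in>carrier G. \<forall>l\<in>carrier G. p k \<noteq> p l \<longrightarrow> R < len (p k \<otimes>\<^bsub>G\<^esub> inv\<^bsub>G\<^esub> (p l)))"
proof -
  interpret group G by (rule group_G)
  have "\<forall>\<^sub>F L in sequentially. \<forall>i\<in>{..<d}. R < s i * real L"
  proof (rule eventually_ball_finite)
    show "\<forall>i\<in>{..<d}. \<forall>\<^sub>F L in sequentially. R < s i * real L"
    proof
      fix i assume "i \<in> {..<d}"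
      then have "0 < s i" using s by simp
      then show "\<forall>\<^sub>F L in sequentially. R < s i * real L"
        by real_asymp
    qed
  qed simp
  then have "\<forall>\<^sub>F L in sequentially. 1 \<le> L \<and> (\<forall>i\<in>{..<d}. R < s i * real L)"
    by (rule eventually_conj[OF eventually_ge_at_top])
  from eventually_happens'[OF sequentially_bot this]
  obtain L :: nat where "1 \<le> L" and L_bound: "\<forall>i\<in>{..<d}. R < s i * real L"
    by blast
  then have L: "0 < L" "\<And>i. i < d \<Longrightarrow> R < s i * real L"
    by simp_all
  define r where "r i z = s i * of_int (int L * \<lfloor>z / (s i * real L)\<rfloor>)" for i z
  define p where "p g = (\<lambda>i\<in>{..<d}. r i (fst g i), \<lambda>j\<in>{..<e}. 0 :: int)" for g :: "(nat \<Rightarrow> real) \<times> (nat \<Rightarrow> int)"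
  have p_eq_iff: "p g = p h \<longleftrightarrow> (\<forall>i<d. r i (fst g i) = r i (fst h i))" for g h
    unfolding p_def prod.inject restrict_def fun_eq_iff by auto
  have p: "p g \<in> carrier G" for g
  proof -
    have "r i z \<in> carrier (lattice_group (s i))" for i z
      unfolding r_def by (rule mem_lattice_group)
    moreover have "0 < n j" if "j < e" for j
      using n[OF that] by simp
    ultimately show ?thesis
      unfolding p_def carrier_G by (intro SigmaI restrict_PiE_iff[THEN iffD2]) auto
  qed
  have cell: "\<bar>z - r i z\<bar> \<le> s i * real L" if "i < d" for i z
  proof -
    have pos: "0 < s i * real L"
      using s[OF that] L by simp
    have "r i z = s i * real L * of_int \<lfloor>z / (s i * real L)\<rfloor>"
      by (simp add: r_def)
    with lattice_cell_diameter[OF pos] show ?thesis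
      by (simp only:)
  qed
  \<comment> \<open>The summand \<open>1\<close> is for the finite coordinates, which contribute at most \<open>1\<close> to the length.\<close>
  define D where "D = 1 + (\<Sum>i<d. s i * real L)"
  have sL: "s i * real L \<le> (\<Sum>i<d. s i * real L)" if "i < d" for i
    by (rule member_le_sum) (use that s in \<open>auto simp: less_imp_le\<close>)
  have sum_nonneg: "0 \<le> (\<Sum>i<d. s i * real L)"
    using s by (intro sum_nonneg) (auto simp: less_imp_le)
  have "len (g \<otimes>\<^bsub>G\<^esub> inv\<^bsub>G\<^esub> (p g)) \<le> D" for g
    unfolding len_le_iff
  proof (intro conjI allI impI)
    fix i assume i: "i < d"
    show "\<bar>fst (g \<otimes>\<^bsub>G\<^esub> inv\<^bsub>G\<^esub> (p g)) i\<bar> \<le> D"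
      using cell[OF i, of "fst g i"] sL[OF i] i
      by (simp add: fst_mult_G inv_G[OF p] D_def) (simp add: p_def)
  qed (use sum_nonneg in \<open>simp add: D_def\<close>)
  moreover define q where "q = L ^ d * (\<Prod>j<e. n j)"
  have "card {x \<in> carrier G. p x = p g} = q" for g
  proof -
    have "{x \<in> carrier G. p x = p g} = (\<Pi>\<^sub>E i\<in>{..<d}. {z \<in> carrier (lattice_group (s i)). r i z = r i (fst g i)})
        \<times> (\<Pi>\<^sub>E j\<in>{..<e}. {0..<int (n j)})"
    proof (rule Set.set_eqI)
      fix x
      show "x \<in> {x \<in> carrier G. p x = p g} \<longleftrightarrow>
          x \<in> (\<Pi>\<^sub>E i\<in>{..<d}. {z \<in> carrier (lattice_group (s i)). r i z = r i (fst g i)})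
            \<times> (\<Pi>\<^sub>E j\<in>{..<e}. {0..<int (n j)})"
        unfolding carrier_G mem_Collect_eq mem_Times_iff PiE_iff p_eq_iff by auto
    qed
    moreover have "card {z \<in> carrier (lattice_group (s i)). r i z = r i (fst g i)} = L" if "i < d" for i
      unfolding r_def by (rule card_lattice_cell) (use s that L in auto)
    ultimately show ?thesis
      by (simp add: card_cartesian_product card_PiE q_def)
  qed
  moreover have "0 < q"
  proof -
    have "0 < n j" if "j < e" for j
      using n[OF that] by simp
    then show ?thesis
      by (simp add: q_def L(1) prod_pos)
  qed
  moreover have "R < len (p g \<otimes>\<^bsub>G\<^esub> inv\<^bsub>G\<^esub> (p h))" if ne: "p g \<noteq> p h" for g h
  proof -
    obtain i where i: "i < d" "r i (fst g i) \<noteq> r i (fst h i)"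
      using ne unfolding p_eq_iff by blast
    define m where "m = \<lfloor>fst g i / (s i * real L)\<rfloor> - \<lfloor>fst h i / (s i * real L)\<rfloor>"
    have eq: "r i (fst g i) - r i (fst h i) = s i * real L * of_int m"
    proof -
      have "r i z = s i * real L * of_int \<lfloor>z / (s i * real L)\<rfloor>" for z
        by (simp add: r_def)
      then show ?thesis
        unfolding m_def of_int_diff right_diff_distrib by (simp only:)
    qed
    have "m \<noteq> 0"
    proof
      assume "m = 0"
      with eq i(2) show False
        by simp
    qed
    then have "1 \<le> \<bar>m\<bar>"
      by simp
    then have "1 \<le> \<bar>of_int m :: real\<bar>"
      by linarith
    have "R < s i * real L"
      by (rule L(2)[OF i(1)])
    also have "\<dots> \<le> s i * real L * \<bar>of_int m\<bar>"
      using mult_left_mono[OF \<open>1 \<le> \<bar>of_int m :: real\<bar>\<close>, of "s i * real L"] s[OF i(1)] by simp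
    also have "\<dots> = \<bar>r i (fst g i) - r i (fst h i)\<bar>"
      unfolding eq using s[OF i(1)] by (simp add: abs_mult)
    also have "\<dots> = \<bar>fst (p g \<otimes>\<^bsub>G\<^esub> inv\<^bsub>G\<^esub> (p h)) i\<bar>"
      using i by (simp add: fst_mult_G inv_G[OF p]) (simp add: p_def)
    also have "\<dots> \<le> len (p g \<otimes>\<^bsub>G\<^esub> inv\<^bsub>G\<^esub> (p h))"
      by (rule len_ge(1)[OF i(1)])
    finally show ?thesis .
  qed
  ultimately show ?thesis
    using p by (intro exI[of _ p] exI[of _ D] exI[of _ q]) auto
qed

lemma tiled_length_group_G: "tiled_length_group G len"
  by (intro tiled_length_group.intro tiled_length_group_axioms.intro length_group_G growth_G tiling_G)

end

section \<open>Removing a set of positive density\<close>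

text \<open>
For one large \<open>N\<close> all windows are nonempty, because the lower density is positive, and finite, because
the upper density is finite, and the average over each of them is less than \<open>\<alpha>\<close>. An average less than
\<open>\<alpha>\<close> over a nonempty finite set has a term that is at most \<open>\<alpha>\<close>.
\<close>

lemma (in length_group) windows_meet_sublevel_set:
  fixes ip :: "'h \<Rightarrow> 'h \<Rightarrow> 'k::real_or_complex"
  assumes lower: "0 < lower_density G len I a" and upper: "upper_density G len I a < \<infinity>"
    and measure: "upper_measure G len ip f f' I a < ereal \<alpha>"
  obtains N where "\<And>j. j \<in> carrier G \<Longrightarrow>
    \<exists>i\<in>{i \<in> I. repart (ip (f i) (f' i)) \<le> \<alpha>}. a i \<in> window G len N j"
proof -
  define \<phi> where "\<phi> i = repart (ip (f i) (f' i))" for i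
  let ?W = "index_window G len I a"
  have "\<forall>\<^sub>F N in sequentially. (SUP j\<in>carrier G.
      ereal (1 / real (card (?W N j)) * (\<Sum>i\<in>?W N j. \<phi> i))) < ereal \<alpha>"
    using Limsup_lessD[OF measure[unfolded upper_measure_def]] by (simp only: \<phi>_def)
  moreover have "\<forall>\<^sub>F N in sequentially. 0 < (INF j\<in>carrier G. density_ratio G len I a N j)"
    using less_LiminfD[OF lower[unfolded lower_density_def]] .
  moreover have "\<forall>\<^sub>F N in sequentially. (SUP j\<in>carrier G. density_ratio G len I a N j) < \<infinity>"
    using Limsup_lessD[OF upper[unfolded upper_density_def]] .
  ultimately have "\<forall>\<^sub>F N in sequentially.
      (SUP j\<in>carrier G. ereal (1 / real (card (?W N j)) * (\<Sum>i\<in>?W N j. \<phi> i))) < ereal \<alpha> \<and>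
      0 < (INF j\<in>carrier G. density_ratio G len I a N j) \<and>
      (SUP j\<in>carrier G. density_ratio G len I a N j) < \<infinity>"
    by (intro eventually_conj)
  from eventually_happens'[OF sequentially_bot this]
  obtain N where N:
    "(SUP j\<in>carrier G. ereal (1 / real (card (?W N j)) * (\<Sum>i\<in>?W N j. \<phi> i))) < ereal \<alpha>"
    "0 < (INF j\<in>carrier G. density_ratio G len I a N j)"
    "(SUP j\<in>carrier G. density_ratio G len I a N j) < \<infinity>"
    by blast
  have "\<exists>i\<in>{i \<in> I. \<phi> i \<le> \<alpha>}. a i \<in> window G len N j" if j: "j \<in> carrier G" for j
  proof (rule ccontr)
    assume "\<not> ?thesis"
    then have large: "\<alpha> \<le> \<phi> i" if "i \<in> ?W N j" for i
      using that by (fastforce simp: index_window_def)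
    have ratio: "0 < density_ratio G len I a N j" "density_ratio G len I a N j < \<infinity>"
      using order_less_le_trans[OF N(2) INF_lower[OF j]] order_le_less_trans[OF SUP_upper[OF j] N(3)]
      by auto
    have ne: "?W N j \<noteq> {}"
    proof
      assume "?W N j = {}"
      then show False
        using ratio(1) by (simp add: density_ratio_def)
    qed
    have fin: "finite (?W N j)"
    proof (rule ccontr)
      assume "infinite (?W N j)"
      then show False
        using ratio(2) by (simp add: density_ratio_def ennreal_top_divide)
    qed
    have card: "0 < real (card (?W N j))"
      using ne fin by (simp add: card_gt_0_iff)
    have "real (card (?W N j)) * \<alpha> \<le> (\<Sum>i\<in>?W N j. \<phi> i)"
      using sum_bounded_below[of "?W N j" \<alpha> \<phi>] large by simp
    then have "\<alpha> \<le> 1 / real (card (?W N j)) * (\<Sum>i\<in>?W N j. \<phi> i)"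
      using card by (simp add: field_simps)
    moreover have "ereal (1 / real (card (?W N j)) * (\<Sum>i\<in>?W N j. \<phi> i)) < ereal \<alpha>"
      by (rule order_le_less_trans[OF SUP_upper[OF j] N(1)])
    ultimately show False
      by simp
  qed
  then show thesis
    unfolding \<phi>_def by (rule that)
qed

text \<open>
The separation \<open>R\<close> comes from the localization and \<open>\<epsilon>\<close>; the set \<open>J\<close> is then built inside
the sublevel set, and Schur's test bounds its Gram matrix by \<open>\<alpha> + \<epsilon>\<close>.
\<close>

lemma (in frame_sequence) removable_set_of_positive_density:
  assumes G: "tiled_length_group G len" and a: "a \<in> I \<rightarrow> carrier G"
    and lower: "0 < lower_density G len I a" and upper: "upper_density G len I a < \<infinity>"
    and localized: "l1_localized G ip f dual I a"
    and measure: "upper_measure G len ip f dual I a < ereal \<alpha>"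
    and \<epsilon>: "0 < \<epsilon>" "\<epsilon> < 1 - \<alpha>"
  shows "\<exists>J \<subseteq> {i \<in> I. repart (ip (f i) (dual i)) \<le> \<alpha>}.
    upper_density G len J a = lower_density G len J a \<and> 0 < lower_density G len J a \<and>
    frame_bounds ip f (I - J) V (A * (1 - \<alpha> - \<epsilon>)) B"
proof -
  interpret G: tiled_length_group G len by (rule G)
  define K where "K = {i \<in> I. repart (ip (f i) (dual i)) \<le> \<alpha>}"
  obtain N where N: "\<And>j. j \<in> carrier G \<Longrightarrow> \<exists>i\<in>K. a i \<in> window G len N j"
    using G.windows_meet_sublevel_set[OF lower upper measure] unfolding K_def by blast
  obtain r where r: "(\<lambda>g. norm (r g)) summable_on carrier G"
    "\<And>i j. i \<in> I \<Longrightarrow> j \<in> I \<Longrightarrow> norm (ip (f i) (dual j)) \<le> r (a i \<otimes>\<^bsub>G\<^esub> inv\<^bsub>G\<^esub> (a j))"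
    using localized unfolding l1_localized_def by blast
  obtain R where R: "0 \<le> R"
    and off_diagonal: "\<And>J F i. J \<subseteq> I \<Longrightarrow>
      (\<And>i j. i \<in> J \<Longrightarrow> j \<in> J \<Longrightarrow> i \<noteq> j \<Longrightarrow> R < len (a i \<otimes>\<^bsub>G\<^esub> inv\<^bsub>G\<^esub> (a j))) \<Longrightarrow>
      finite F \<Longrightarrow> F \<subseteq> J \<Longrightarrow> i \<in> F \<Longrightarrow>
      (\<Sum>j\<in>F - {i}. norm (ip (f i) (dual j))) \<le> \<epsilon> \<and> (\<Sum>j\<in>F - {i}. norm (ip (f j) (dual i))) \<le> \<epsilon>"
    using G.small_off_diagonal[OF r(1) \<epsilon>(1) a r(2)] by metis
  obtain J where J: "J \<subseteq> K" "upper_density G len J a = lower_density G len J a"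
    "0 < lower_density G len J a"
    and sep: "\<And>i j. i \<in> J \<Longrightarrow> j \<in> J \<Longrightarrow> i \<noteq> j \<Longrightarrow> R < len (a i \<otimes>\<^bsub>G\<^esub> inv\<^bsub>G\<^esub> (a j))"
    using G.separated_subset_with_density[OF N R] by metis
  have JI: "J \<subseteq> I"
    using J(1) by (auto simp: K_def)
  have diag: "norm (ip (f i) (dual i)) \<le> \<alpha>" if "i \<in> K" for i
    using that norm_ip_dual_self by (simp add: K_def)
  obtain i where "i \<in> K"
    using N[OF G.one_closed] by blast
  \<comment> \<open>The bound \<open>\<alpha>\<close> is not negative since the sublevel set is nonempty and the diagonal entries are not negative.\<close>
  from diag[OF this] have "0 \<le> \<alpha>"
    using norm_ge_zero order_trans by blast
  have "frame_bounds ip f (I - J) V (A * (1 - (\<alpha> + \<epsilon>))) B"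
  proof (rule frame_bounds_remove[OF JI])
    show "0 < \<alpha> + \<epsilon>" "\<alpha> + \<epsilon> < 1"
      using \<open>0 \<le> \<alpha>\<close> \<epsilon> by auto
    fix F c assume F: "finite F" "F \<subseteq> J"
    show "norm (\<Sum>i\<in>F. \<Sum>j\<in>F. c i * cnjg (c j) * ip (f i) (dual j))
        \<le> (\<alpha> + \<epsilon>) * (\<Sum>i\<in>F. (norm (c i))\<^sup>2)"
    proof (rule schur_test[OF F(1)])
      show "norm (ip (f i) (dual i)) \<le> \<alpha>" if "i \<in> F" for i
        using that F J(1) diag by blast
      show "(\<Sum>j\<in>F - {i}. norm (ip (f i) (dual j))) \<le> \<epsilon>" if "i \<in> F" for i
        using off_diagonal[OF JI sep F that] by simp
      show "(\<Sum>i\<in>F - {j}. norm (ip (f i) (dual j))) \<le> \<epsilon>" if "j \<in> F" for j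
        using off_diagonal[OF JI sep F that] by simp
    qed
  qed
  then have "frame_bounds ip f (I - J) V (A * (1 - \<alpha> - \<epsilon>)) B"
    by (simp add: diff_diff_eq)
  with J show ?thesis
    unfolding K_def by blast
qed

theorem theorem3p8:
  fixes smul :: "'k::real_or_complex \<Rightarrow> 'h::banach \<Rightarrow> 'h"
    and ip :: "'h \<Rightarrow> 'h \<Rightarrow> 'k"
    and d e :: nat and s :: "nat \<Rightarrow> real" and n :: "nat \<Rightarrow> nat"
    and G :: "((nat \<Rightarrow> real) \<times> (nat \<Rightarrow> int)) monoid"
    and len :: "(nat \<Rightarrow> real) \<times> (nat \<Rightarrow> int) \<Rightarrow> real"
    and I :: "'i set" and f f' :: "'i \<Rightarrow> 'h"
    and a :: "'i \<Rightarrow> (nat \<Rightarrow> real) \<times> (nat \<Rightarrow> int)"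
    and A B :: real and V :: "'h set"
  assumes hilbert: "inner_product_space smul ip"
    and separable: "separable_space (euclidean :: 'h topology)"
    and d: "1 \<le> d" and s: "\<And>i. i < d \<Longrightarrow> 0 < s i" and n: "\<And>j. j < e \<Longrightarrow> 1 \<le> n j"
    and G: "G = index_group d s e n" and len: "len = index_length d e"
    and I: "countable I" and a: "a \<in> I \<rightarrow> carrier G"
    and V: "V = closed_span smul (f ` I)"
    and frame_sequence: "frame_bounds ip f I V A B"
    and f': "f' = canonical_dual smul ip f I"
    and density: "0 < lower_density G len I a"
      "lower_density G len I a \<le> upper_density G len I a"
      "upper_density G len I a < \<infinity>"
    and localized: "l1_localized G ip f f' I a"
    and measure: "upper_measure G len ip f f' I a < 1"
  shows "(\<exists>J\<subseteq>I. upper_density G len J a = lower_density G len J a \<and>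
            0 < lower_density G len J a \<and> is_frame ip f (I - J) V) \<and>
         (\<forall>\<alpha>::real. upper_measure G len ip f f' I a < ereal \<alpha> \<and> \<alpha> < 1 \<longrightarrow>
            (\<forall>\<epsilon>::real. 0 < \<epsilon> \<and> \<epsilon> < 1 - \<alpha> \<longrightarrow>
              (\<exists>J \<subseteq> {i \<in> I. repart (ip (f i) (f' i)) \<le> \<alpha>}.
                 upper_density G len J a = lower_density G len J a \<and>
                 0 < lower_density G len J a \<and>
                 frame_bounds ip f (I - J) V (A * (1 - \<alpha> - \<epsilon>)) B)))"
proof -
  have "frame_sequence smul ip f I A B"
    using hilbert frame_sequence unfolding V
    by (intro frame_sequence.intro frame_sequence_axioms.intro)
  moreover have "tiled_length_group G len"
    unfolding G len by (rule index_group_data.tiled_length_group_G[OF index_group_data.intro[OF d s n]])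
  ultimately have removable: "\<exists>J \<subseteq> {i \<in> I. repart (ip (f i) (f' i)) \<le> \<alpha>}.
      upper_density G len J a = lower_density G len J a \<and> 0 < lower_density G len J a \<and>
      frame_bounds ip f (I - J) V (A * (1 - \<alpha> - \<epsilon>)) B"
    if "upper_measure G len ip f f' I a < ereal \<alpha>" "0 < \<epsilon>" "\<epsilon> < 1 - \<alpha>" for \<alpha> \<epsilon>
    using that a density(1,3) localized unfolding f' V
    by (intro frame_sequence.removable_set_of_positive_density)
  have "upper_measure G len ip f f' I a < ereal 1"
    using measure by (simp add: one_ereal_def)
  then obtain \<alpha> where "upper_measure G len ip f f' I a < ereal \<alpha>" "ereal \<alpha> < ereal 1"
    using ereal_dense2 by blast
  then obtain J where "J \<subseteq> {i \<in> I. repart (ip (f i) (f' i)) \<le> \<alpha>}"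
      "upper_density G len J a = lower_density G len J a" "0 < lower_density G len J a"
      "frame_bounds ip f (I - J) V (A * (1 - \<alpha> - (1 - \<alpha>) / 2)) B"
    using removable[of \<alpha> "(1 - \<alpha>) / 2"] by auto
  then have "\<exists>J\<subseteq>I. upper_density G len J a = lower_density G len J a \<and>
      0 < lower_density G len J a \<and> is_frame ip f (I - J) V"
    unfolding is_frame_def by (intro exI[of _ J]) blast
  with removable show ?thesis
    by blast
qed

end
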